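(* Let $n\ge 1$, let $p\in\{0,1,2,\dots\}\cup\{+\infty\}$ and let $\Omega\subseteq\mathbb{C}^n$ satisfy the star condition. Then: 1. For any $\zeta\in\partial\Omega$, the set of functions in $A^p(\Omega)$ that are not holomorphically extendable at $\zeta$ is a dense $G_\delta$ subset of $A^p(\Omega)$. 2. The set of non-holomorphically extendable functions in $A^p(\Omega)$ is a dense $G_\delta$ subset of $A^p(\Omega)$. In particular, items 1 and 2 hold for every open and convex $\Omega\subseteq\mathbb{C}^n$.
   Context: Star condition: $\Omega\subseteq\mathbb{C}^n$ satisfies the star condition if $\Omega$ is open and connected and for every $\zeta\in\partial\Omega$ there are points $w\in\mathbb{C}^n\setminus\overline{\Omega}$ arbitrarily close to $\zeta$ for which there is a nonzero $v\in\mathbb{C}^n$ such that the complex hyperplane $H=\{z\in\mathbb{C}^n:\langle z,v\rangle=\langle w,v\rangle\}$ is disjoint from $\overline{\Omega}$. Here $\langle\cdot,\cdot\rangle$ is the usual complex inner product. $A^p(\Omega)$: for $\Omega\subseteq\mathbb{C}^n$ open and connected, $A^p(\Omega)$ is the set of holomorphic functions $f:\Omega\to\mathbb{C}$ such that $\frac{\partial^{\alpha}f}{\partial z^{\alpha}}$ extends continuously to $\overline{\Omega}$ for every multi-index $\alpha\in\mathbb{N}^n$ with $|\alpha|\le p$ (all $\alpha$ if $p=+\infty$). Its topology is given by the seminorms $|f|_{\alpha,N}=\sup_{z\in\overline{\Omega},\,\|z\|\le N}\left|\frac{\partial^{\alpha}f}{\partial z^{\alpha}}(z)\right|$, $|\alpha|\le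 p$, $N\in\mathbb{N}$; it is a Fréchet space. Extendability: a holomorphic function $f$ on $\Omega$ is holomorphically extendable at $\zeta\in\partial\Omega$ if there are an open ball $B(\zeta,r)$, $r>0$, and a holomorphic function $F:B(\zeta,r)\to\mathbb{C}$ such that $F=f$ on some connected component of $B(\zeta,r)\cap\Omega$. The function $f$ is non-holomorphically extendable if it is not holomorphically extendable at any point of $\partial\Omega$. *)

theory Defs
  imports "HOL-Analysis.Analysis"
begin

definition cinner :: "complex^'n \<Rightarrow> complex^'n \<Rightarrow> complex" where
  "cinner z w = (\<Sum>j\<in>UNIV. z $ j * cnj (w $ j))"

definition star_condition :: "(complex^'n) set \<Rightarrow> bool" where
  "star_condition \<Omega> \<longleftrightarrow> open \<Omega> \<and> connected \<Omega> \<and>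
     (\<forall>\<zeta>\<in>frontier \<Omega>. \<forall>e>0. \<exists>w. w \<notin> closure \<Omega> \<and> dist w \<zeta> < e \<and>
        (\<exists>v. v \<noteq> 0 \<and> {z. cinner z v = cinner w v} \<inter> closure \<Omega> = {}))"

(* The library's holomorphic_on covers functions of one variable only.  In several variables:
   the Frechet derivative exists at every point and is complex linear. *)
definition holomorphic_several :: "(complex^'n \<Rightarrow> complex) \<Rightarrow> (complex^'n) set \<Rightarrow> bool" where
  "holomorphic_several f S \<longleftrightarrow>
     (\<forall>z\<in>S. \<exists>L. (f has_derivative L) (at z) \<and> (\<forall>c x. L (c *s x) = c * L x))"

definition cpartial :: "'n \<Rightarrow> (complex^'n \<Rightarrow> complex) \<Rightarrow> complex^'n \<Rightarrow> complex" where
  "cpartial j f z = deriv (\<lambda>t. f (z + axis j t)) 0"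

(* An arbitrary enumeration of the index type.  It only fixes the order in which the partial
   derivatives below are taken; for holomorphic functions the order is immaterial. *)
definition index_enum :: "'n::finite list" where
  "index_enum = (SOME js. set js = UNIV \<and> distinct js)"

lemma index_enum: "set (index_enum :: 'n::finite list) = UNIV \<and> distinct (index_enum :: 'n list)"
  unfolding index_enum_def by (rule someI_ex) (use finite_distinct_list[of "UNIV :: 'n set"] in auto)

definition mderiv :: "('n \<Rightarrow> nat) \<Rightarrow> (complex^'n \<Rightarrow> complex) \<Rightarrow> complex^'n \<Rightarrow> complex" where
  "mderiv \<alpha> f = foldr (\<lambda>j g. (cpartial j ^^ \<alpha> j) g) index_enum f"

definition mi_order :: "('n::finite \<Rightarrow> nat) \<Rightarrow> nat" where
  "mi_order \<alpha> = (\<Sum>j\<in>UNIV. \<alpha> j)"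

definition extends_cont :: "(complex^'n) set \<Rightarrow> (complex^'n \<Rightarrow> complex) \<Rightarrow> bool" where
  "extends_cont \<Omega> g \<longleftrightarrow> (\<exists>h. continuous_on (closure \<Omega>) h \<and> (\<forall>z\<in>\<Omega>. h z = g z))"

definition closure_ext :: "(complex^'n) set \<Rightarrow> (complex^'n \<Rightarrow> complex) \<Rightarrow> complex^'n \<Rightarrow> complex" where
  "closure_ext \<Omega> g z = (if z \<in> \<Omega> then g z else Lim (at z within \<Omega>) g)"

lemma closure_ext_eq:
  assumes "continuous_on (closure \<Omega>) h" "\<And>z. z \<in> \<Omega> \<Longrightarrow> h z = g z" "z \<in> closure \<Omega>"
  shows "closure_ext \<Omega> g z = h z"
proof (cases "z \<in> \<Omega>")
  case False
  then have "z islimpt \<Omega>"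
    using assms(3) by (simp add: closure_def)
  then have nontriv: "at z within \<Omega> \<noteq> bot"
    by (simp add: trivial_limit_within)
  have "(h \<longlongrightarrow> h z) (at z within closure \<Omega>)"
    using assms(1,3) by (simp add: continuous_on_def)
  then have "(h \<longlongrightarrow> h z) (at z within \<Omega>)"
    by (rule tendsto_within_subset) (rule closure_subset)
  moreover have "\<forall>\<^sub>F x in at z within \<Omega>. h x = g x"
    using assms(2) by (simp add: eventually_at_filter)
  ultimately have "(g \<longlongrightarrow> h z) (at z within \<Omega>)"
    by (rule Lim_transform_eventually)
  then show ?thesis
    using False nontriv by (simp add: closure_ext_def tendsto_Lim)
qed (use assms(2) in \<open>simp add: closure_ext_def\<close>)

(* A function on \<Omega> is represented by the total function that vanishes outside \<Omega>, so that equal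
   functions on \<Omega> are equal elements of the space.  p = \<infinity> is allowed. *)
definition A_space :: "enat \<Rightarrow> (complex^'n) set \<Rightarrow> (complex^'n \<Rightarrow> complex) set" where
  "A_space p \<Omega> = {f. (\<forall>z. z \<notin> \<Omega> \<longrightarrow> f z = 0) \<and> holomorphic_several f \<Omega> \<and>
     (\<forall>\<alpha>. enat (mi_order \<alpha>) \<le> p \<longrightarrow> extends_cont \<Omega> (mderiv \<alpha> f))}"

(* Inserting 0 makes the supremum over the empty set equal to 0. *)
definition A_seminorm ::
    "(complex^'n) set \<Rightarrow> ('n \<Rightarrow> nat) \<Rightarrow> nat \<Rightarrow> (complex^'n \<Rightarrow> complex) \<Rightarrow> real" where
  "A_seminorm \<Omega> \<alpha> N f =
     Sup (insert 0 ((\<lambda>z. norm (closure_ext \<Omega> (mderiv \<alpha> f) z)) ` {z \<in> closure \<Omega>. norm z \<le> real N}))"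

definition A_topology :: "enat \<Rightarrow> (complex^'n) set \<Rightarrow> (complex^'n \<Rightarrow> complex) topology" where
  "A_topology p \<Omega> = topology_generated_by
     {{g \<in> A_space p \<Omega>. A_seminorm \<Omega> \<alpha> N (\<lambda>z. g z - f z) < e} | f \<alpha> N e.
        f \<in> A_space p \<Omega> \<and> enat (mi_order \<alpha>) \<le> p \<and> 0 < e}"

lemma topspace_A_topology:
  fixes \<Omega> :: "(complex^'n) set"
  shows "topspace (A_topology p \<Omega>) = A_space p \<Omega>"
proof -
  have "cpartial j (\<lambda>_. 0) = (\<lambda>_. 0)" for j :: 'n
    by (simp add: cpartial_def fun_eq_iff)
  then have "(cpartial j ^^ k) (\<lambda>_. 0) = (\<lambda>_. 0)" for j :: 'n and k
    by (induction k) auto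
  then have "foldr (\<lambda>j g. (cpartial j ^^ \<alpha> j) g) js (\<lambda>_. 0) = (\<lambda>_. 0)" for \<alpha> and js :: "'n list"
    by (induction js) auto
  then have zero: "mderiv \<alpha> (\<lambda>_. 0) = (\<lambda>_. 0)" for \<alpha> :: "'n \<Rightarrow> nat"
    by (simp add: mderiv_def)
  have "closure_ext \<Omega> (\<lambda>_. 0) z = 0" if "z \<in> closure \<Omega>" for z
    using closure_ext_eq[of \<Omega> "\<lambda>_. 0" "\<lambda>_. 0" z] that by simp
  then have "insert 0 ((\<lambda>z. norm (closure_ext \<Omega> (mderiv \<alpha> (\<lambda>_. 0)) z)) `
               {z \<in> closure \<Omega>. norm z \<le> real N}) = {0}" for \<alpha> N
    by (auto simp: zero)
  then have sn: "A_seminorm \<Omega> \<alpha> N (\<lambda>_. 0) = 0" for \<alpha> N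
    by (simp only: A_seminorm_def) simp
  have "f \<in> topspace (A_topology p \<Omega>)" if "f \<in> A_space p \<Omega>" for f
  proof -
    let ?B = "{g \<in> A_space p \<Omega>. A_seminorm \<Omega> (\<lambda>_. 0) 0 (\<lambda>z. g z - f z) < 1}"
    have "f \<in> ?B"
      using that by (simp add: sn)
    moreover have "enat (mi_order (\<lambda>_ :: 'n. 0)) \<le> p"
      by (simp add: mi_order_def flip: zero_enat_def)
    then have "?B \<in> {{g \<in> A_space p \<Omega>. A_seminorm \<Omega> \<alpha> N (\<lambda>z. g z - f z) < e} | f \<alpha> N e.
        f \<in> A_space p \<Omega> \<and> enat (mi_order \<alpha>) \<le> p \<and> 0 < e}"
      using that zero_less_one by blast
    ultimately show ?thesis
      unfolding A_topology_def topology_generated_by_topspace by blast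
  qed
  then show ?thesis
    by (auto simp: A_topology_def)
qed

definition extendable_at ::
    "(complex^'n) set \<Rightarrow> (complex^'n \<Rightarrow> complex) \<Rightarrow> complex^'n \<Rightarrow> bool" where
  "extendable_at \<Omega> f \<zeta> \<longleftrightarrow>
     (\<exists>r>0. \<exists>F. holomorphic_several F (ball \<zeta> r) \<and>
        (\<exists>C\<in>components (ball \<zeta> r \<inter> \<Omega>). \<forall>z\<in>C. F z = f z))"

definition non_extendable :: "(complex^'n) set \<Rightarrow> (complex^'n \<Rightarrow> complex) \<Rightarrow> bool" where
  "non_extendable \<Omega> f \<longleftrightarrow> (\<forall>\<zeta>\<in>frontier \<Omega>. \<not> extendable_at \<Omega> f \<zeta>)"

definition dense_gdelta_in :: "'a topology \<Rightarrow> 'a set \<Rightarrow> bool" where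
  "dense_gdelta_in X S \<longleftrightarrow> gdelta_in X S \<and> X closure_of S = topspace X"

end

theory Submission
  imports Defs "HOL-Complex_Analysis.Complex_Analysis" "HOL-Real_Asymp.Real_Asymp"
begin

text \<open>
  The idea is Baire's theorem, applied in the Frechet space \<open>A_space p \<Omega>\<close>, to the sets
  \<open>boundedly_extendable p \<Omega> \<zeta> r C M\<close>: the functions that agree on \<open>C\<close>, a component of
  \<open>ball \<zeta> r \<inter> \<Omega>\<close>, with a holomorphic function on \<open>ball \<zeta> r\<close> bounded by \<open>M\<close>.

  These sets are closed by a normal families argument (\<open>Vitali_several\<close>): if functions of the set
  converge uniformly on \<open>C\<close>, then their extensions, being bounded by the same \<open>M\<close>, converge locally
  uniformly on the whole ball. They have empty interior because of the star condition: it provides a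
  point \<open>w\<close> of the ball outside \<open>closure \<Omega>\<close> and a complex hyperplane through \<open>w\<close> that misses
  \<open>closure \<Omega>\<close>, so that \<open>g z = 1 / (cinner z v - cinner w v)\<close> belongs to every \<open>A_space p \<Omega>\<close>
  and has a pole at \<open>w\<close>. If both \<open>f\<close> and \<open>f + t g\<close> with \<open>t \<noteq> 0\<close> were extendable to the ball
  from \<open>C\<close>, then so would be \<open>g\<close>, which the identity theorem on the complex line from a point of
  \<open>C\<close> to \<open>w\<close> forbids.

  It remains to see that countably many of these sets exhaust the extendable functions. For a fixed
  \<open>\<zeta>\<close> this holds as one can shrink the ball to a rational radius, which bounds the extension, and as
  an open set has only countably many components. For all \<open>\<zeta>\<close> together it suffices to let \<open>\<zeta>\<close> range
  over a countable dense subset of the frontier: a function that is extendable at some frontier point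
  from a component \<open>C\<close> is extendable at all frontier points near a point \<open>\<eta>\<close> at which \<open>C\<close> touches
  the frontier of \<open>\<Omega>\<close> inside the ball.

  The analysis in several variables rests on the restriction of functions to complex lines, where
  Cauchy's estimates are available. They show that complex linear Frechet derivatives of a locally
  uniformly convergent sequence converge (\<open>Weierstrass_several\<close>). Consequently partial derivatives of
  holomorphic functions, as limits of difference quotients, are holomorphic, and \<open>A_space p \<Omega>\<close> is
  complete. A convex open set satisfies the star condition because
  a real hyperplane through \<open>w\<close> that misses \<open>closure \<Omega>\<close> contains a complex one.
\<close>

section \<open>Countable families of pseudometrics\<close>

text \<open>
  The supremum of the pseudometrics \<open>q i\<close>, the \<open>i\<close>-th of them capped at a height \<open>w i\<close>, is a
  metric for the topology that they generate: since the heights tend to \<open>0\<close>, a small ball for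
  the supremum constrains only finitely many of the \<open>q i\<close>.
\<close>

lemma completely_metrizable_pseudometric_family:
  fixes q :: "'i::countable \<Rightarrow> 'a \<Rightarrow> 'a \<Rightarrow> real" and I :: "'i set" and A :: "'a set"
  assumes "I \<noteq> {}"
    and nonneg: "\<And>i x y. i \<in> I \<Longrightarrow> x \<in> A \<Longrightarrow> y \<in> A \<Longrightarrow> 0 \<le> q i x y"
    and refl: "\<And>i x. i \<in> I \<Longrightarrow> x \<in> A \<Longrightarrow> q i x x = 0"
    and sym: "\<And>i x y. i \<in> I \<Longrightarrow> x \<in> A \<Longrightarrow> y \<in> A \<Longrightarrow> q i x y = q i y x"
    and tri: "\<And>i x y z. i \<in> I \<Longrightarrow> x \<in> A \<Longrightarrow> y \<in> A \<Longrightarrow> z \<in> A \<Longrightarrow> q i x z \<le> q i x y + q i y z"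
    and sep: "\<And>x y. x \<in> A \<Longrightarrow> y \<in> A \<Longrightarrow> (\<And>i. i \<in> I \<Longrightarrow> q i x y = 0) \<Longrightarrow> x = y"
    and complete: "\<And>s :: nat \<Rightarrow> 'a. range s \<subseteq> A \<Longrightarrow>
        (\<And>i e. i \<in> I \<Longrightarrow> 0 < e \<Longrightarrow> \<exists>N. \<forall>m\<ge>N. \<forall>n\<ge>N. q i (s m) (s n) < e) \<Longrightarrow>
        \<exists>x\<in>A. \<forall>i\<in>I. \<forall>e>0. \<exists>N. \<forall>n\<ge>N. q i (s n) x < e"
  shows "completely_metrizable_space
           (topology_generated_by {{y \<in> A. q i y x < e} | x i e. x \<in> A \<and> i \<in> I \<and> 0 < e})"
    (is "completely_metrizable_space (topology_generated_by ?\<B>)")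
proof -
  let ?T = "topology_generated_by ?\<B>"
  define w where "w i = inverse (real (Suc (to_nat i)))" for i :: 'i
  define D where "D x y = (if x \<in> A \<and> y \<in> A then SUP i\<in>I. min (q i x y) (w i) else 0)" for x y
  have w_pos: "0 < w i" for i by (simp add: w_def)
  have w_le: "w i \<le> 1" for i by (simp add: w_def field_simps)
  have fin: "finite {i \<in> I. e < w i}" if "0 < e" for e
  proof -
    have "to_nat ` {i \<in> I. e < w i} \<subseteq> {..nat \<lceil>1 / e\<rceil>}"
    proof (rule image_subsetI)
      fix i assume "i \<in> {i \<in> I. e < w i}"
      then have "real (Suc (to_nat i)) < 1 / e"
        using that by (simp add: w_def field_simps)
      then show "to_nat i \<in> {..nat \<lceil>1 / e\<rceil>}" by simp linarith
    qed
    then show ?thesis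
      by (meson finite_imageD finite_atMost finite_subset inj_on_subset inj_to_nat subset_UNIV)
  qed
  have bdd: "bdd_above ((\<lambda>i. min (q i x y) (w i)) ` I)" for x y
    by (rule bdd_aboveI2[of _ _ 1]) (use w_le in \<open>simp add: min_le_iff_disj\<close>)
  have D_le: "D x y \<le> e \<longleftrightarrow> (\<forall>i\<in>I. q i x y \<le> e \<or> w i \<le> e)" if "x \<in> A" "y \<in> A" for x y e
    using that \<open>I \<noteq> {}\<close> bdd by (simp add: D_def cSUP_le_iff min_le_iff_disj)
  have D_ge: "min (q i x y) (w i) \<le> D x y" if "x \<in> A" "y \<in> A" "i \<in> I" for x y i
    using that cSUP_upper[OF that(3) bdd[of x y]] by (simp add: D_def)
  have D_nonneg: "0 \<le> D x y" for x y
  proof (cases "x \<in> A \<and> y \<in> A")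
    case True
    obtain i where "i \<in> I" using \<open>I \<noteq> {}\<close> by blast
    then have "0 \<le> min (q i x y) (w i)" using True nonneg w_pos by (simp add: less_imp_le)
    then show ?thesis using D_ge True \<open>i \<in> I\<close> by (meson order_trans)
  qed (auto simp: D_def)
  interpret M: Metric_space A D
  proof
    show "0 \<le> D x y" for x y by (rule D_nonneg)
    show "D x y = D y x" for x y
    proof (cases "x \<in> A \<and> y \<in> A")
      case True
      then have "(\<lambda>i. min (q i x y) (w i)) ` I = (\<lambda>i. min (q i y x) (w i)) ` I"
        by (intro image_cong) (auto simp: sym)
      then show ?thesis by (simp add: D_def)
    qed (auto simp: D_def)
    show "D x y = 0 \<longleftrightarrow> x = y" if "x \<in> A" "y \<in> A" for x y
    proof
      assume "D x y = 0"
      then have "q i x y \<le> 0" if "i \<in> I" for i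
        using D_le[of x y 0] \<open>x \<in> A\<close> \<open>y \<in> A\<close> w_pos[of i] that by force
      then have "q i x y = 0" if "i \<in> I" for i
        using nonneg[of i x y] \<open>x \<in> A\<close> \<open>y \<in> A\<close> that by (simp add: antisym)
      then show "x = y" using sep that by blast
    next
      assume "x = y"
      then have "D x y \<le> 0" using D_le refl that by fastforce
      then show "D x y = 0" using D_nonneg by (simp add: order_antisym)
    qed
    show "D x z \<le> D x y + D y z" if A: "x \<in> A" "y \<in> A" "z \<in> A" for x y z
    proof -
      have "q i x z \<le> D x y + D y z \<or> w i \<le> D x y + D y z" if "i \<in> I" for i
        using D_ge[of x y i] D_ge[of y z i] tri[of i x y z] D_nonneg[of x y] D_nonneg[of y z] that A
        by (auto simp: min_le_iff_disj)
      then show ?thesis using D_le A by blast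
    qed
  qed
  have q_less: "q i x y < e" if "D x y < min e (w i)" "x \<in> A" "y \<in> A" "i \<in> I" for i x y e
    using D_ge[of x y i] that by (auto simp: min_le_iff_disj)
  have "openin ?T U \<longleftrightarrow> openin M.mtopology U" for U
  proof
    assume "openin M.mtopology U"
    then have U: "U \<subseteq> A" "\<And>x. x \<in> U \<Longrightarrow> \<exists>r>0. M.mball x r \<subseteq> U"
      by (auto simp: M.openin_mtopology)
    show "openin ?T U"
    proof (subst openin_subopen, rule ballI)
      fix x assume "x \<in> U"
      then obtain r where r: "0 < r" "M.mball x r \<subseteq> U" and "x \<in> A" using U by blast
      obtain i0 where "i0 \<in> I" using \<open>I \<noteq> {}\<close> by blast
      let ?J = "insert i0 {i \<in> I. r/2 < w i}"
      let ?V = "\<Inter>i\<in>?J. {y \<in> A. q i y x < r/2}"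
      have J: "?J \<subseteq> I" using \<open>i0 \<in> I\<close> by blast
      have "openin ?T ?V"
      proof (intro openin_INT2 topology_generated_by_Basis)
        show "finite ?J" using fin[of "r/2"] r by simp
        show "{y \<in> A. q i y x < r/2} \<in> ?\<B>" if "i \<in> ?J" for i
          using J that \<open>x \<in> A\<close> r half_gt_zero by blast
      qed auto
      moreover have "x \<in> ?V" using J refl \<open>x \<in> A\<close> r by auto
      moreover have "?V \<subseteq> U"
      proof
        fix y assume y: "y \<in> ?V"
        then have "y \<in> A" by blast
        moreover have "q i y x \<le> r/2 \<or> w i \<le> r/2" if "i \<in> I" for i
          using y that by (cases "r/2 < w i") auto
        ultimately have "D y x \<le> r/2" using D_le \<open>x \<in> A\<close> by blast
        then have "y \<in> M.mball x r" using r \<open>y \<in> A\<close> \<open>x \<in> A\<close> M.commute[of y x] by (simp add: M.in_mball)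
        then show "y \<in> U" using r by blast
      qed
      ultimately show "\<exists>V. openin ?T V \<and> x \<in> V \<and> V \<subseteq> U" by blast
    qed
  next
    have gen: "openin M.mtopology S" if "S \<in> ?\<B>" for S
    proof -
      obtain x i e where S: "S = {y \<in> A. q i y x < e}" "x \<in> A" "i \<in> I" "0 < e"
        using \<open>S \<in> ?\<B>\<close> by blast
      have "\<exists>r>0. M.mball y r \<subseteq> S" if "y \<in> S" for y
      proof (intro exI conjI)
        show "0 < min (e - q i y x) (w i)" using that S w_pos by auto
        show "M.mball y (min (e - q i y x) (w i)) \<subseteq> S"
        proof
          fix z assume "z \<in> M.mball y (min (e - q i y x) (w i))"
          then have "y \<in> A" "z \<in> A" "D y z < min (e - q i y x) (w i)" by (auto simp: M.in_mball)
          moreover from this have "q i y z < e - q i y x" using q_less S by blast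
          ultimately show "z \<in> S" using tri[of i z y x] sym[of i z y] S by simp
        qed
      qed
      then show ?thesis using S by (auto simp: M.openin_mtopology)
    qed
    assume "openin ?T U"
    then show "openin M.mtopology U"
      using generate_topology_on_coarsest[OF istopology_openin gen] openin_topology_generated_by
      by blast
  qed
  then have T: "?T = M.mtopology" by (simp add: topology_eq)
  have "M.mcomplete"
    unfolding M.mcomplete_def
  proof (intro allI impI)
    fix s assume s: "M.MCauchy s"
    have "\<exists>N. \<forall>m\<ge>N. \<forall>n\<ge>N. q i (s m) (s n) < e" if "i \<in> I" "0 < e" for i e
    proof -
      have "0 < min e (w i)" using that w_pos by simp
      then obtain N where "\<forall>m n. N \<le> m \<longrightarrow> N \<le> n \<longrightarrow> D (s m) (s n) < min e (w i)"
        using s unfolding M.MCauchy_def by blast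
      moreover have "s n \<in> A" for n using s unfolding M.MCauchy_def by blast
      ultimately show ?thesis using q_less \<open>i \<in> I\<close> by blast
    qed
    moreover have sA: "range s \<subseteq> A" using s by (simp add: M.MCauchy_def)
    ultimately obtain x where x: "x \<in> A" "\<And>i e. i \<in> I \<Longrightarrow> 0 < e \<Longrightarrow> \<exists>N. \<forall>n\<ge>N. q i (s n) x < e"
      using complete[of s] by blast
    have "\<exists>N. \<forall>n\<ge>N. s n \<in> A \<and> D (s n) x < e" if "0 < e" for e
    proof -
      let ?J = "{i \<in> I. e/2 < w i}"
      have "\<forall>i\<in>?J. \<exists>N. \<forall>n\<ge>N. q i (s n) x < e/2"
        using x(2)[of _ "e/2"] that by simp
      then obtain N where N: "\<And>i n. i \<in> ?J \<Longrightarrow> n \<ge> N i \<Longrightarrow> q i (s n) x < e/2"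
        by metis
      have "D (s n) x \<le> e/2" if "n \<ge> Max (insert 0 (N ` ?J))" for n
      proof -
        have "q i (s n) x \<le> e/2 \<or> w i \<le> e/2" if "i \<in> I" for i
        proof (cases "i \<in> ?J")
          case True
          then have "N i \<le> n"
            using \<open>n \<ge> _\<close> fin[of "e/2"] \<open>0 < e\<close> by (auto)
          then show ?thesis using N True less_imp_le by blast
        qed (use that in auto)
        then show ?thesis using D_le sA x by blast
      qed
      then have "\<forall>n\<ge>Max (insert 0 (N ` ?J)). s n \<in> A \<and> D (s n) x < e"
        using sA \<open>0 < e\<close> by fastforce
      then show ?thesis by blast
    qed
    then have "limitin M.mtopology s x sequentially"
      using x(1) by (auto simp: M.limitin_metric eventually_sequentially)
    then show "\<exists>x. limitin M.mtopology s x sequentially" ..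
  qed
  then show ?thesis using T M.completely_metrizable_space_mtopology by simp
qed

section \<open>Holomorphic functions on complex lines\<close>

lemma norm_vector_smult: "norm (c *s x) = cmod c * norm (x :: complex^'n)"
  by (simp add: norm_vec_def norm_mult L2_set_right_distrib)

lemma bounded_linear_smult_left: "bounded_linear (\<lambda>t. t *s (u :: complex^'n))"
  by (rule bounded_linear_intro[where K = "norm u"])
     (auto simp: vec_eq_iff norm_vector_smult algebra_simps)

lemma line_has_derivative:
  "((\<lambda>t. z + t *s (u :: complex^'n)) has_derivative (\<lambda>s. s *s u)) (at t)"
  using bounded_linear.has_derivative[OF bounded_linear_smult_left has_derivative_ident]
  by (auto intro!: derivative_eq_intros)

lemma has_field_derivative_along_line:
  fixes f :: "complex^'n \<Rightarrow> complex"
  assumes "(f has_derivative L) (at (z + t *s u))" "\<And>c x. L (c *s x) = c * L x"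
  shows "((\<lambda>t. f (z + t *s u)) has_field_derivative L u) (at t)"
proof -
  have "((\<lambda>t. f (z + t *s u)) has_derivative (\<lambda>s. L (s *s u))) (at t)"
    using has_derivative_compose[OF line_has_derivative assms(1)] .
  moreover have "(\<lambda>s. L (s *s u)) = (*) (L u)"
    by (simp add: assms(2) fun_eq_iff)
  ultimately show ?thesis by (simp add: has_field_derivative_def)
qed

lemma holomorphic_severalE:
  assumes "holomorphic_several f S" "z \<in> S"
  obtains L where "(f has_derivative L) (at z)" "\<And>c x. L (c *s x) = c * L x"
  using assms unfolding holomorphic_several_def by blast

lemma holomorphic_several_subset:
  "holomorphic_several f S \<Longrightarrow> T \<subseteq> S \<Longrightarrow> holomorphic_several f T"
  by (auto simp: holomorphic_several_def)

lemma holomorphic_several_local: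
  assumes "\<And>z. z \<in> S \<Longrightarrow> \<exists>r>0. holomorphic_several f (ball z r)"
  shows "holomorphic_several f S"
  unfolding holomorphic_several_def
proof
  fix z assume "z \<in> S"
  from assms[OF this] obtain r where "0 < r" "holomorphic_several f (ball z r)" by (elim exE conjE)
  then show "\<exists>L. (f has_derivative L) (at z) \<and> (\<forall>c x. L (c *s x) = c * L x)"
    using holomorphic_severalE[of f "ball z r" z] centre_in_ball by metis
qed

lemma holomorphic_several_imp_continuous_on:
  "holomorphic_several f S \<Longrightarrow> continuous_on S f"
  by (metis continuous_at_imp_continuous_on has_derivative_continuous holomorphic_several_def)

lemma holomorphic_several_along_line:
  fixes f :: "complex^'n \<Rightarrow> complex"
  assumes "holomorphic_several f S" "\<And>t. t \<in> T \<Longrightarrow> z + t *s u \<in> S"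
  shows "(\<lambda>t. f (z + t *s u)) holomorphic_on T"
proof (unfold holomorphic_on_def, rule ballI)
  fix t assume "t \<in> T"
  then obtain L where "(f has_derivative L) (at (z + t *s u))" "\<And>c x. L (c *s x) = c * L x"
    using assms holomorphic_severalE by blast
  then show "(\<lambda>t. f (z + t *s u)) field_differentiable at t within T"
    using has_field_derivative_along_line field_differentiable_def field_differentiable_at_within
    by blast
qed

lemma holomorphic_several_cmult_add:
  assumes f: "holomorphic_several f S" and g: "holomorphic_several g S"
  shows "holomorphic_several (\<lambda>z. f z + a * g z) S"
  unfolding holomorphic_several_def
proof
  fix z assume "z \<in> S"
  then obtain L K where L: "(f has_derivative L) (at z)" "\<And>c x. L (c *s x) = c * L x"
    and K: "(g has_derivative K) (at z)" "\<And>c x. K (c *s x) = c * K x"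
    using f g holomorphic_severalE by metis
  have "((\<lambda>z. f z + a * g z) has_derivative (\<lambda>x. L x + a * K x)) (at z)"
    using L K by (auto intro!: derivative_eq_intros)
  then show "\<exists>L. ((\<lambda>z. f z + a * g z) has_derivative L) (at z) \<and> (\<forall>c x. L (c *s x) = c * L x)"
    using L(2) K(2) by (intro exI[of _ "\<lambda>x. L x + a * K x"]) (simp add: algebra_simps)
qed

lemma holomorphic_several_translate:
  assumes "holomorphic_several f S" "\<And>z. z \<in> T \<Longrightarrow> z + a \<in> S"
  shows "holomorphic_several (\<lambda>z. f (z + a)) T"
  unfolding holomorphic_several_def
proof
  fix z assume "z \<in> T"
  then obtain L where L: "(f has_derivative L) (at (z + a))" "\<And>c x. L (c *s x) = c * L x"
    using assms holomorphic_severalE by metis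
  have "((\<lambda>z. z + a) has_derivative (\<lambda>x. x)) (at z)"
    by (auto intro!: derivative_eq_intros)
  from has_derivative_compose[OF this L(1)] L(2)
  show "\<exists>L. ((\<lambda>z. f (z + a)) has_derivative L) (at z) \<and> (\<forall>c x. L (c *s x) = c * L x)"
    by blast
qed

text \<open>
  Displacements along a coordinate axis are multiples of one vector, so facts about arbitrary
  complex lines apply to partial derivatives.
\<close>

lemma cpartial_eq_deriv_along_line: "cpartial j f z = deriv (\<lambda>t. f (z + t *s axis j 1)) 0"
proof -
  have "axis j t = t *s axis j 1" for t :: complex by (simp add: vec_eq_iff axis_def)
  then have "(\<lambda>t. f (z + axis j t)) = (\<lambda>t. f (z + t *s axis j 1))" by metis
  then show ?thesis by (simp add: cpartial_def)
qed

lemma cpartial_eq_derivative: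
  assumes "(f has_derivative L) (at z)" "\<And>c x. L (c *s x) = c * L x"
  shows "cpartial j f z = L (axis j 1)"
proof -
  have "((\<lambda>t. f (z + t *s axis j 1)) has_field_derivative L (axis j 1)) (at 0)"
    using assms by (intro has_field_derivative_along_line) auto
  then show ?thesis by (simp add: cpartial_eq_deriv_along_line DERIV_imp_deriv)
qed

section \<open>Cauchy estimates and the Weierstrass theorem\<close>

text \<open>
  The functions to which this is applied are controlled on open discs only, so Cauchy's inequality is
  used on the circle of half the radius.
\<close>

lemma Cauchy_inequality_ball:
  assumes "g holomorphic_on ball a r" "\<And>t. t \<in> ball a r \<Longrightarrow> cmod (g t) \<le> B" "0 < r"
  shows "cmod ((deriv ^^ n) g a) \<le> fact n * B / (r/2) ^ n"
proof (rule Cauchy_inequality)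
  show "g holomorphic_on ball a (r/2)"
    using assms by (auto intro: holomorphic_on_subset)
  have "cball a (r/2) \<subseteq> ball a r" using assms by auto
  then show "continuous_on (cball a (r/2)) g"
    using assms(1) holomorphic_on_imp_continuous_on continuous_on_subset by blast
  show "cmod (g x) \<le> B" if "cmod (a - x) = r/2" for x
    using assms that by (simp add: dist_norm)
qed (use assms in simp)

text \<open>
  The one-variable estimate on the complex line through \<open>z\<close> in direction \<open>h\<close>, which meets
  the ball in a disc of radius \<open>r / norm h\<close>. Being uniform in the direction, it controls the operator
  norm of the derivative.
\<close>

lemma Cauchy_inequality_directional:
  fixes f :: "complex^'n \<Rightarrow> complex"
  assumes hol: "holomorphic_several f (ball z r)"
    and B: "\<And>y. y \<in> ball z r \<Longrightarrow> cmod (f y) \<le> B" and "0 < r"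
    and L: "(f has_derivative L) (at z)" "\<And>c x. L (c *s x) = c * L x"
  shows "cmod (L h) \<le> 2 * B / r * norm h"
proof (cases "h = 0")
  case True
  then show ?thesis using L(2)[of 0 0] by simp
next
  case False
  define g where "g t = f (z + t *s h)" for t
  have inball: "z + t *s h \<in> ball z r" if "t \<in> ball 0 (r / norm h)" for t
    using that False by (simp add: dist_norm norm_vector_smult field_simps)
  have "g holomorphic_on ball 0 (r / norm h)"
    unfolding g_def using hol inball by (rule holomorphic_several_along_line)
  moreover have "deriv g 0 = L h"
    unfolding g_def using has_field_derivative_along_line[of f L z 0 h] L
    by (simp add: DERIV_imp_deriv)
  ultimately show ?thesis
    using Cauchy_inequality_ball[of g 0 "r / norm h" B 1] False \<open>0 < r\<close> B inball
    by (simp add: g_def mult_ac)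
qed

definition locally_uniform_limit ::
    "'a::metric_space set \<Rightarrow> (nat \<Rightarrow> 'a \<Rightarrow> 'b::metric_space) \<Rightarrow> ('a \<Rightarrow> 'b) \<Rightarrow> bool" where
  "locally_uniform_limit S F f \<longleftrightarrow> (\<forall>z\<in>S. \<exists>r>0. uniform_limit (ball z r) F f sequentially)"

lemma locally_uniform_limit_tendsto:
  assumes "locally_uniform_limit S F f" "z \<in> S"
  shows "(\<lambda>k. F k z) \<longlonglongrightarrow> f z"
  using assms tendsto_uniform_limitI unfolding locally_uniform_limit_def
  by (metis centre_in_ball)

text \<open>
  Cauchy's estimate turns uniform closeness of the functions into closeness of their Frechet
  derivatives in operator norm on the ball of half the radius. This is what allows one to differentiate
  the limit.
\<close>

lemma Weierstrass_several_ball: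
  fixes F :: "nat \<Rightarrow> complex^'n \<Rightarrow> complex"
  assumes "0 < r" and hol: "\<And>k. holomorphic_several (F k) (ball z r)"
    and lim: "uniform_limit (ball z r) F f sequentially"
  shows "holomorphic_several f (ball z (r/2))"
    and "uniform_limit (ball z (r/2)) (\<lambda>k. cpartial j (F k)) (cpartial j f) sequentially"
proof -
  have "\<forall>k. \<forall>y\<in>ball z r. \<exists>L. (F k has_derivative L) (at y) \<and> (\<forall>c x. L (c *s x) = c * L x)"
    using hol by (simp add: holomorphic_several_def)
  then obtain L where L: "\<And>k y. y \<in> ball z r \<Longrightarrow> (F k has_derivative L k y) (at y)"
      "\<And>k y c x. y \<in> ball z r \<Longrightarrow> L k y (c *s x) = c * L k y x"
    by metis
  have sub: "ball y (r/2) \<subseteq> ball z r" if "y \<in> ball z (r/2)" for y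
    using that by (simp add: ball_subset_ball_iff dist_commute)
  have half: "y \<in> ball z r" if "y \<in> ball z (r/2)" for y using that \<open>0 < r\<close> by auto
  have cauchy: "\<exists>N. \<forall>y\<in>ball z (r/2). \<forall>h. \<forall>k\<ge>N. \<forall>l\<ge>N. cmod (L k y h - L l y h) \<le> e * norm h"
    if "0 < e" for e
  proof -
    have "0 < e * r / 8" using that \<open>0 < r\<close> by simp
    then obtain N where N: "\<And>k y. k \<ge> N \<Longrightarrow> y \<in> ball z r \<Longrightarrow> dist (F k y) (f y) < e * r / 8"
      using lim unfolding uniform_limit_iff eventually_sequentially by meson
    have "cmod (L k y h - L l y h) \<le> e * norm h"
      if y: "y \<in> ball z (r/2)" and "k \<ge> N" "l \<ge> N" for y h k l
    proof -
      let ?G = "\<lambda>x. F k x + (-1) * F l x"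
      have "cmod (?G x) \<le> e * r / 4" if "x \<in> ball y (r/2)" for x
      proof -
        have "x \<in> ball z r" using sub y that by blast
        then have "dist (F k x) (F l x) < e * r / 4"
          using N[of k x] N[of l x] \<open>k \<ge> N\<close> \<open>l \<ge> N\<close> dist_triangle2[of "F k x" "F l x" "f x"]
          by simp
        then show ?thesis by (simp add: dist_norm)
      qed
      moreover have "holomorphic_several ?G (ball y (r/2))"
        by (intro holomorphic_several_cmult_add holomorphic_several_subset[OF hol sub] y)
      moreover have "(?G has_derivative (\<lambda>h. L k y h + (-1) * L l y h)) (at y)"
        using L(1)[OF half[OF y]] by (auto intro!: derivative_eq_intros)
      ultimately have "cmod (L k y h + (-1) * L l y h) \<le> 2 * (e * r / 4) / (r/2) * norm h"
        using \<open>0 < r\<close> L(2)[OF half[OF y]]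
        by (intro Cauchy_inequality_directional[of ?G y "r/2"]) (auto simp: algebra_simps)
      then show ?thesis using \<open>0 < r\<close> by simp
    qed
    then show ?thesis by blast
  qed
  define L' where "L' y h = lim (\<lambda>k. L k y h)" for y h
  have L'_lim: "(\<lambda>k. L k y h) \<longlonglongrightarrow> L' y h" if y: "y \<in> ball z (r/2)" for y h
  proof -
    have "Cauchy (\<lambda>k. L k y h)"
    proof (rule metric_CauchyI)
      fix e :: real assume "0 < e"
      then have "0 < e / (norm h + 1)" by (simp add: add_nonneg_pos)
      then obtain N where N: "\<forall>k\<ge>N. \<forall>l\<ge>N. cmod (L k y h - L l y h) \<le> e / (norm h + 1) * norm h"
        using cauchy y by meson
      have "e / (norm h + 1) * norm h < e"
        using \<open>0 < e\<close> by (simp add: divide_simps add_nonneg_pos)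
      then show "\<exists>N. \<forall>m\<ge>N. \<forall>n\<ge>N. dist (L m y h) (L n y h) < e"
        using N unfolding dist_norm by (meson order_le_less_trans)
    qed
    then show ?thesis unfolding L'_def
      by (simp add: Cauchy_convergent_iff convergent_LIMSEQ_iff)
  qed
  have L'_unif: "\<forall>\<^sub>F k in sequentially. \<forall>y\<in>ball z (r/2). \<forall>h. cmod (L k y h - L' y h) \<le> e * norm h"
    if "0 < e" for e
  proof -
    obtain N where N: "\<forall>y\<in>ball z (r/2). \<forall>h. \<forall>k\<ge>N. \<forall>l\<ge>N. cmod (L k y h - L l y h) \<le> e * norm h"
      using cauchy \<open>0 < e\<close> by blast
    have "cmod (L k y h - L' y h) \<le> e * norm h" if "k \<ge> N" "y \<in> ball z (r/2)" for k y h
    proof (rule LIMSEQ_le_const2)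
      show "(\<lambda>l. cmod (L k y h - L l y h)) \<longlonglongrightarrow> cmod (L k y h - L' y h)"
        using L'_lim[OF that(2)] by (intro tendsto_intros)
      show "\<exists>N. \<forall>n\<ge>N. cmod (L k y h - L n y h) \<le> e * norm h"
        using N that by blast
    qed
    then show ?thesis unfolding eventually_sequentially by blast
  qed
  have f_lim: "(\<lambda>k. F k y) \<longlonglongrightarrow> f y" if "y \<in> ball z r" for y
    using lim that by (rule tendsto_uniform_limitI)
  obtain g where g: "\<And>y. y \<in> ball z (r/2) \<Longrightarrow> (\<lambda>k. F k y) \<longlonglongrightarrow> g y"
      "\<And>y. y \<in> ball z (r/2) \<Longrightarrow> (g has_derivative L' y) (at y within ball z (r/2))"
  proof -
    have "\<exists>g. \<forall>y\<in>ball z (r/2). (\<lambda>k. F k y) \<longlonglongrightarrow> g y \<and> (g has_derivative L' y) (at y within ball z (r/2))"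
    proof (rule has_derivative_sequence)
      show "(F n has_derivative L n x) (at x within ball z (r/2))" if "x \<in> ball z (r/2)" for n x
        using L(1) half that has_derivative_at_withinI by blast
      show "(\<lambda>n. F n z) \<longlonglongrightarrow> f z" using f_lim \<open>0 < r\<close> by simp
      show "z \<in> ball z (r/2)" using \<open>0 < r\<close> by simp
      show "convex (ball z (r/2))" by (rule convex_ball)
    qed (rule L'_unif)
    then obtain g where "\<forall>y\<in>ball z (r/2). (\<lambda>k. F k y) \<longlonglongrightarrow> g y \<and> (g has_derivative L' y) (at y within ball z (r/2))" ..
    then show ?thesis by (intro that[of g]) simp_all
  qed
  have f': "(f has_derivative L' y) (at y)" if y: "y \<in> ball z (r/2)" for y
  proof -
    have "(g has_derivative L' y) (at y)"
      using g(2)[OF y] at_within_open[OF y open_ball] by metis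
    moreover have "g x = f x" if "x \<in> ball z (r/2)" for x
      by (rule LIMSEQ_unique[OF g(1)[OF that] f_lim[OF half[OF that]]])
    ultimately show ?thesis
      using has_derivative_transform_within_open[of g "L' y" y UNIV "ball z (r/2)" f] y by auto
  qed
  have L'_lin: "L' y (c *s x) = c * L' y x" if y: "y \<in> ball z (r/2)" for y c x
  proof (rule LIMSEQ_unique[OF L'_lim[OF y]])
    show "(\<lambda>k. L k y (c *s x)) \<longlonglongrightarrow> c * L' y x"
      using L'_lim[OF y] L(2)[OF half[OF y]] by (simp add: tendsto_mult_left)
  qed
  show "holomorphic_several f (ball z (r/2))"
    unfolding holomorphic_several_def using f' L'_lin by blast
  have "\<forall>\<^sub>F k in sequentially. \<forall>y\<in>ball z (r/2). dist (cpartial j (F k) y) (cpartial j f y) < e"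
    if "0 < e" for e
  proof -
    have "0 < e/2" using that by simp
    from L'_unif[OF this] show ?thesis
    proof eventually_elim
      case (elim k)
      show ?case
      proof
        fix y assume y: "y \<in> ball z (r/2)"
        have "cpartial j (F k) y = L k y (axis j 1)" "cpartial j f y = L' y (axis j 1)"
          using cpartial_eq_derivative L half f' L'_lin y by blast+
        moreover have "cmod (L k y (axis j 1) - L' y (axis j 1)) \<le> e/2 * norm (axis j (1::complex))"
          using elim y by blast
        ultimately show "dist (cpartial j (F k) y) (cpartial j f y) < e"
          using \<open>0 < e\<close> by (simp add: dist_norm)
      qed
    qed
  qed
  then show "uniform_limit (ball z (r/2)) (\<lambda>k. cpartial j (F k)) (cpartial j f) sequentially"
    by (simp add: uniform_limit_iff)
qed

lemma Weierstrass_several: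
  fixes F :: "nat \<Rightarrow> complex^'n \<Rightarrow> complex"
  assumes "open S" and hol: "\<And>k. holomorphic_several (F k) S" and lim: "locally_uniform_limit S F f"
  shows "holomorphic_several f S"
    and "locally_uniform_limit S (\<lambda>k. cpartial j (F k)) (cpartial j f)"
proof -
  have *: "\<exists>r>0. holomorphic_several f (ball z (r/2)) \<and>
      uniform_limit (ball z (r/2)) (\<lambda>k. cpartial j (F k)) (cpartial j f) sequentially"
    if "z \<in> S" for z
  proof -
    have "\<exists>r>0. uniform_limit (ball z r) F f sequentially"
      using lim that by (simp add: locally_uniform_limit_def)
    then obtain r where r: "0 < r" "uniform_limit (ball z r) F f sequentially" by (elim exE conjE)
    obtain s where s: "0 < s" "ball z s \<subseteq> S"
      using \<open>open S\<close> \<open>z \<in> S\<close> by (rule openE)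
    have "uniform_limit (ball z (min r s)) F f sequentially"
      using r(2) by (rule uniform_limit_on_subset) auto
    moreover have "holomorphic_several (F k) (ball z (min r s))" for k
      using hol s by (rule_tac holomorphic_several_subset) auto
    moreover have "0 < min r s" using r(1) s(1) by simp
    ultimately show ?thesis
      by (intro exI[of _ "min r s"] conjI Weierstrass_several_ball[where F = F])
  qed
  show "holomorphic_several f S"
  proof (rule holomorphic_several_local)
    fix z assume "z \<in> S"
    from *[OF this] obtain r where "r > 0" "holomorphic_several f (ball z (r/2))"
      by (elim exE conjE)
    then show "\<exists>r>0. holomorphic_several f (ball z r)" by (intro exI[of _ "r/2"]) simp
  qed
  show "locally_uniform_limit S (\<lambda>k. cpartial j (F k)) (cpartial j f)"
    unfolding locally_uniform_limit_def
  proof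
    fix z assume "z \<in> S"
    from *[OF this] obtain r where "r > 0"
        "uniform_limit (ball z (r/2)) (\<lambda>k. cpartial j (F k)) (cpartial j f) sequentially"
      by (elim exE conjE)
    then show "\<exists>r>0. uniform_limit (ball z r) (\<lambda>k. cpartial j (F k)) (cpartial j f) sequentially"
      by (intro exI[of _ "r/2"]) simp
  qed
qed

text \<open>
  Taylor's formula of order one, with the second derivative bounded by Cauchy's inequality on discs of
  radius \<open>r\<close> about points of \<open>ball 0 r\<close>. The uniformity of the bound in \<open>g\<close> is the point.
\<close>

lemma difference_quotient_estimate:
  assumes hol: "g holomorphic_on ball 0 (2*r)" and M: "\<And>t. t \<in> ball 0 (2*r) \<Longrightarrow> cmod (g t) \<le> M"
    and h: "h \<noteq> 0" "cmod h < r"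
  shows "cmod ((g h - g 0) / h - deriv g 0) \<le> 8 * M / r\<^sup>2 * cmod h"
proof -
  have "0 < r" using h(2) norm_ge_zero[of h] by linarith
  have "cmod (g h - (\<Sum>i\<le>1. (deriv ^^ i) g 0 * (h - 0) ^ i / fact i))
          \<le> (8 * M / r\<^sup>2) * cmod (h - 0) ^ Suc 1 / fact 1"
  proof (rule complex_Taylor[where S = "ball 0 r" and f = "\<lambda>i. (deriv ^^ i) g", simplified funpow_0])
    fix i :: nat and x :: complex assume x: "x \<in> ball 0 r"
    have "(deriv ^^ i) g holomorphic_on ball 0 (2*r)"
      using hol by (simp add: holomorphic_higher_deriv)
    then have "(deriv ^^ i) g field_differentiable at x"
      using x \<open>0 < r\<close> by (auto intro: holomorphic_on_imp_differentiable_at)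
    then show "((deriv ^^ i) g has_field_derivative (deriv ^^ Suc i) g x) (at x within ball 0 r)"
      by (simp add: field_differentiable_derivI has_field_derivative_at_within)
  next
    fix x :: complex assume x: "x \<in> ball 0 r"
    have "ball x r \<subseteq> ball 0 (2*r)" using x by (simp add: ball_subset_ball_iff)
    then have "cmod ((deriv ^^ 2) g x) \<le> fact 2 * M / (r/2) ^ 2"
      using \<open>0 < r\<close> hol M by (intro Cauchy_inequality_ball) (auto intro: holomorphic_on_subset)
    then show "cmod ((deriv ^^ Suc 1) g x) \<le> 8 * M / r\<^sup>2"
      by (simp add: numeral_2_eq_2 power2_eq_square)
  qed (use h \<open>0 < r\<close> in auto)
  then have "cmod (g h - g 0 - deriv g 0 * h) \<le> (8 * M / r\<^sup>2) * cmod h * cmod h"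
    by (simp add: algebra_simps power2_eq_square)
  moreover have "(g h - g 0) / h - deriv g 0 = (g h - g 0 - deriv g 0 * h) / h"
    using h by (simp add: field_simps)
  ultimately show ?thesis using h by (simp add: norm_divide pos_divide_le_eq)
qed

text \<open>
  Locally, \<open>cpartial j f\<close> is the uniform limit of difference quotients of \<open>f\<close>, which are
  holomorphic, and the Weierstrass theorem applies.
\<close>

lemma holomorphic_several_cpartial:
  fixes f :: "complex^'n \<Rightarrow> complex"
  assumes "open S" "holomorphic_several f S"
  shows "holomorphic_several (cpartial j f) S"
proof -
  have "\<exists>r>0. holomorphic_several (cpartial j f) (ball z r)" if "z \<in> S" for z
  proof -
    obtain R where R: "0 < R" "cball z R \<subseteq> S"
      using \<open>open S\<close> \<open>z \<in> S\<close> open_contains_cball by blast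
    \<comment> \<open>Then \<open>y + t *s axis j 1\<close> stays in \<open>cball z R\<close> for \<open>y \<in> ball z r\<close> and \<open>cmod t < 2 r\<close>, as \<open>r + 2 r \<le> R\<close>.\<close>
    define r where "r = R / 4"
    have "0 < r" using R by (simp add: r_def)
    have "continuous_on (cball z R) f"
      using holomorphic_several_imp_continuous_on[OF assms(2)] R(2) by (rule continuous_on_subset)
    then have "bounded (f ` cball z R)"
      by (intro compact_imp_bounded compact_continuous_image compact_cball)
    then obtain M where "\<forall>x\<in>f ` cball z R. cmod x \<le> M" unfolding bounded_iff ..
    then have M: "cmod (f y) \<le> M" if "y \<in> cball z R" for y using that by (rule bspec[OF _ imageI])
    let ?e = "axis j 1 :: complex^'n"
    define h where "h k = complex_of_real (r / (real k + 2))" for k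
    have h_norm: "cmod (h k) = r / (real k + 2)" for k
      unfolding h_def using \<open>0 < r\<close> by (subst norm_of_real) (simp add: field_simps)
    have h_less: "cmod (h k) < r" for k
      using \<open>0 < r\<close> by (simp add: h_norm field_simps add_pos_nonneg)
    have h_nz: "h k \<noteq> 0" for k
      using \<open>0 < r\<close> unfolding h_def of_real_eq_0_iff by (simp add: add_nonneg_eq_0_iff)
    define Q where "Q k y = (1 / h k) * (f (y + h k *s ?e) + (-1) * f y)" for k y
    have inR: "y + t *s ?e \<in> cball z R" if "y \<in> ball z r" "t \<in> ball 0 (2*r)" for y t
    proof -
      have "dist z (y + t *s ?e) \<le> dist z y + cmod t"
        using norm_triangle_ineq4[of "z - y" "t *s ?e"]
        by (simp add: dist_norm norm_vector_smult diff_diff_eq)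
      then show ?thesis using that R by (simp add: r_def)
    qed
    have "holomorphic_several (Q k) (ball z r)" for k
    proof -
      have 1: "holomorphic_several (\<lambda>y. f (y + h k *s ?e)) (ball z r)"
      proof (rule holomorphic_several_translate[OF assms(2)])
        have "h k \<in> ball 0 (2*r)" using h_less[of k] \<open>0 < r\<close> by simp
        then show "y + h k *s ?e \<in> S" if "y \<in> ball z r" for y using inR[OF that] R(2) by blast
      qed
      have 2: "holomorphic_several f (ball z r)"
      proof (rule holomorphic_several_subset[OF assms(2)])
        have "ball z r \<subseteq> cball z R" using R(1) by (auto simp: r_def)
        then show "ball z r \<subseteq> S" using R(2) by (rule order_trans)
      qed
      have 3: "holomorphic_several (\<lambda>y. 0) (ball z r)"
        unfolding holomorphic_several_def by (intro ballI exI[of _ "\<lambda>_. 0"]) auto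
      show ?thesis
        using holomorphic_several_cmult_add[OF 3 holomorphic_several_cmult_add[OF 1 2, of "-1"], of "1 / h k"]
        by (simp add: Q_def[abs_def])
    qed
    moreover have "uniform_limit (ball z r) Q (cpartial j f) sequentially"
    proof (rule uniform_limitI)
      fix e :: real assume "0 < e"
      have est: "dist (Q k y) (cpartial j f y) \<le> 8 * M / r\<^sup>2 * cmod (h k)" if "y \<in> ball z r" for k y
      proof -
        define g where "g t = f (y + t *s ?e)" for t
        have "g holomorphic_on ball 0 (2*r)"
          unfolding g_def using inR[OF that] R assms(2)
          by (intro holomorphic_several_along_line) blast+
        then have "cmod ((g (h k) - g 0) / h k - deriv g 0) \<le> 8 * M / r\<^sup>2 * cmod (h k)"
          by (rule difference_quotient_estimate)
             (use inR[OF that] M h_less h_nz in \<open>auto simp: g_def\<close>)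
        then show ?thesis
          by (simp add: dist_norm g_def[abs_def] Q_def cpartial_eq_deriv_along_line)
      qed
      have "h \<longlonglongrightarrow> 0"
      proof (rule tendsto_norm_zero_cancel)
        show "(\<lambda>k. cmod (h k)) \<longlonglongrightarrow> 0" unfolding h_norm by real_asymp
      qed
      then have "(\<lambda>k. 8 * M / r\<^sup>2 * cmod (h k)) \<longlonglongrightarrow> 8 * M / r\<^sup>2 * cmod 0"
        by (intro tendsto_intros)
      then have "\<forall>\<^sub>F k in sequentially. 8 * M / r\<^sup>2 * cmod (h k) < e"
        using \<open>0 < e\<close> by (simp add: order_tendstoD(2))
      then show "\<forall>\<^sub>F k in sequentially. \<forall>y\<in>ball z r. dist (Q k y) (cpartial j f y) < e"
        by eventually_elim (use est order_le_less_trans in blast)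
    qed
    ultimately have "holomorphic_several (cpartial j f) (ball z (r/2))"
      using \<open>0 < r\<close> by (intro Weierstrass_several_ball(1)[where F = Q])
    then show ?thesis using \<open>0 < r\<close> by (intro exI[of _ "r/2"]) simp
  qed
  then show ?thesis by (rule holomorphic_several_local)
qed

section \<open>Vitali's theorem\<close>

text \<open>
  A quantitative identity theorem: in the Taylor series at \<open>0\<close> the tail is small by the bound
  \<open>M\<close> on the large disc, uniformly in \<open>g\<close>, and each of the remaining finitely many coefficients is small
  by the bound \<open>\<epsilon>\<close> near \<open>0\<close>. Radius \<open>4\<close> is such that Cauchy's inequality on the disc of half the
  radius makes the tail geometric at \<open>1\<close>.
\<close>

lemma small_near_zero_imp_small_at_one:
  assumes "0 < \<delta>" "0 \<le> M" "0 < \<eta>"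
  shows "\<exists>\<epsilon>>0. \<forall>g. g holomorphic_on ball 0 4 \<longrightarrow> (\<forall>t\<in>ball 0 4. cmod (g t) \<le> M) \<longrightarrow>
           (\<forall>t\<in>ball 0 \<delta>. cmod (g t) \<le> \<epsilon>) \<longrightarrow> cmod (g 1) \<le> \<eta>"
proof -
  define d where "d = min \<delta> 4"
  have "0 < d" "d \<le> \<delta>" "d \<le> 4" using assms by (auto simp: d_def)
  have "(\<lambda>N. M * (1/2) ^ N * 2) \<longlonglongrightarrow> M * 0 * 2"
    by (intro tendsto_intros LIMSEQ_power_zero) auto
  from order_tendstoD(2)[OF this, of "\<eta> / 2"]
  have "\<forall>\<^sub>F N in sequentially. M * (1/2) ^ N * 2 < \<eta> / 2"
    using assms by simp
  then obtain N where N: "M * (1/2) ^ N * 2 < \<eta> / 2"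
    by (meson eventually_sequentially order_refl)
  define S where "S = (\<Sum>n<N. (2/d) ^ n)"
  have "0 \<le> S" unfolding S_def using \<open>0 < d\<close> by (intro sum_nonneg) auto
  define \<epsilon> where "\<epsilon> = \<eta> / 2 / (S + 1)"
  have "0 < \<epsilon>" unfolding \<epsilon>_def using assms \<open>0 \<le> S\<close> by simp
  have eS: "\<epsilon> * S \<le> \<eta> / 2"
    unfolding \<epsilon>_def using assms \<open>0 \<le> S\<close> by (simp add: field_simps)
  have "cmod (g 1) \<le> \<eta>"
    if hol: "g holomorphic_on ball 0 4" and M: "\<forall>t\<in>ball 0 4. cmod (g t) \<le> M"
      and e: "\<forall>t\<in>ball 0 \<delta>. cmod (g t) \<le> \<epsilon>" for g
  proof -
    define a where "a n = (deriv ^^ n) g 0 / fact n" for n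
    have "a sums g 1"
      using holomorphic_power_series[OF hol, of 1] by (simp add: a_def[abs_def])
    have a_M: "cmod (a n) \<le> M * (1/2) ^ n" for n
    proof -
      have "cmod ((deriv ^^ n) g 0) \<le> fact n * M / (4/2) ^ n"
        using M by (intro Cauchy_inequality_ball hol) auto
      then show ?thesis by (simp add: a_def norm_divide field_simps power_divide)
    qed
    have a_e: "cmod (a n) \<le> \<epsilon> * (2/d) ^ n" for n
    proof -
      have "cmod ((deriv ^^ n) g 0) \<le> fact n * \<epsilon> / (d/2) ^ n"
        using e \<open>0 < d\<close> \<open>d \<le> \<delta>\<close> \<open>d \<le> 4\<close>
        by (intro Cauchy_inequality_ball holomorphic_on_subset[OF hol]) auto
      then show ?thesis using \<open>0 < d\<close> by (simp add: a_def norm_divide field_simps power_divide)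
    qed
    have geo: "(\<lambda>n. M * (1/2) ^ N * (1/2) ^ n) sums (M * (1/2) ^ N * 2)"
      using geometric_sums[of "1/2 :: real"] by (intro sums_mult) simp
    have "cmod (\<Sum>n. a (n + N)) \<le> (\<Sum>n. M * (1/2) ^ N * (1/2) ^ n)"
    proof (rule norm_suminf_le)
      show "cmod (a (n + N)) \<le> M * (1/2) ^ N * (1/2) ^ n" for n
        using a_M[of "n + N"] by (simp add: power_add mult_ac)
    qed (use geo in \<open>simp add: sums_iff\<close>)
    then have tail: "cmod (\<Sum>n. a (n + N)) \<le> \<eta> / 2"
      using geo N by (simp add: sums_iff)
    have "cmod (\<Sum>n<N. a n) \<le> (\<Sum>n<N. \<epsilon> * (2/d) ^ n)"
      by (rule sum_norm_le) (rule a_e)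
    then have head: "cmod (\<Sum>n<N. a n) \<le> \<eta> / 2"
      using eS by (simp add: S_def sum_distrib_left)
    have "g 1 = (\<Sum>n. a (n + N)) + (\<Sum>n<N. a n)"
      using suminf_split_initial_segment[of a N] \<open>a sums g 1\<close> by (simp add: sums_iff)
    then show ?thesis
      using norm_triangle_ineq[of "\<Sum>n. a (n + N)" "\<Sum>n<N. a n"] head tail by simp
  qed
  then show ?thesis using \<open>0 < \<epsilon>\<close> by (intro exI[of _ \<epsilon>]) simp
qed

text \<open>
  The previous lemma on the complex lines through \<open>a\<close>, applied to the differences of the functions.
  The new radius \<open>R / 4\<close> does not depend on \<open>\<delta>\<close>, which is what makes convergence spread.
\<close>

lemma uniformly_Cauchy_on_larger_ball:
  fixes F :: "nat \<Rightarrow> complex^'n \<Rightarrow> complex"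
  assumes hol: "\<And>k. holomorphic_several (F k) (ball a R)"
    and M: "\<And>k y. y \<in> ball a R \<Longrightarrow> cmod (F k y) \<le> M"
    and "0 < R" "0 < \<delta>" and cau: "uniformly_Cauchy_on (ball a \<delta>) F"
  shows "uniformly_Cauchy_on (ball a (R/4)) F"
  unfolding uniformly_Cauchy_on_def
proof (intro allI impI)
  fix e :: real assume "0 < e"
  have "cmod (F 0 a) \<le> M" using M \<open>0 < R\<close> by simp
  then have "0 \<le> M" by (rule order_trans[OF norm_ge_zero])
  \<comment> \<open>For \<open>norm u < R / 4\<close> the disc of radius \<open>4 \<delta> / R\<close> is mapped into \<open>ball a \<delta>\<close> by \<open>\<lambda>t. a + t *s u\<close>.\<close>
  have "0 < 4 * \<delta> / R" "0 \<le> 2 * M" "0 < e/2"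
    using \<open>0 < R\<close> \<open>0 < \<delta>\<close> \<open>0 \<le> M\<close> \<open>0 < e\<close> by auto
  from small_near_zero_imp_small_at_one[OF this] obtain \<epsilon> where "0 < \<epsilon>"
    and \<epsilon>: "\<And>g. g holomorphic_on ball 0 4 \<Longrightarrow> (\<And>t. t \<in> ball 0 4 \<Longrightarrow> cmod (g t) \<le> 2 * M) \<Longrightarrow>
           (\<And>t. t \<in> ball 0 (4 * \<delta> / R) \<Longrightarrow> cmod (g t) \<le> \<epsilon>) \<Longrightarrow> cmod (g 1) \<le> e/2"
    by (elim exE conjE) blast
  obtain N where N: "\<And>x m n. x \<in> ball a \<delta> \<Longrightarrow> m \<ge> N \<Longrightarrow> n \<ge> N \<Longrightarrow> dist (F m x) (F n x) < \<epsilon>"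
    using cau \<open>0 < \<epsilon>\<close> unfolding uniformly_Cauchy_on_def by meson
  have "dist (F m y) (F n y) < e" if y: "y \<in> ball a (R/4)" and "m \<ge> N" "n \<ge> N" for y m n
  proof -
    define u where "u = y - a"
    define g where "g t = F m (a + t *s u) + (-1) * F n (a + t *s u)" for t
    have u: "norm u < R/4" using y by (simp add: u_def dist_norm norm_minus_commute)
    have in_ball: "a + t *s u \<in> ball a (s * R / 4)" if "t \<in> ball 0 s" for t s
    proof -
      have "cmod t * norm u \<le> cmod t * (R/4)" using u by (intro mult_left_mono) auto
      also have "\<dots> < s * (R/4)" using that \<open>0 < R\<close> by (intro mult_strict_right_mono) auto
      finally show ?thesis by (simp add: dist_norm norm_vector_smult)
    qed
    have "cmod (g 1) \<le> e/2"
    proof (rule \<epsilon>)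
      have "holomorphic_several (\<lambda>x. F m x + (-1) * F n x) (ball a R)"
        by (intro holomorphic_several_cmult_add hol)
      then show "g holomorphic_on ball 0 4"
        unfolding g_def by (rule holomorphic_several_along_line) (use in_ball[of _ 4] in simp)
      show "cmod (g t) \<le> 2 * M" if "t \<in> ball 0 4" for t
      proof -
        have "a + t *s u \<in> ball a R" using in_ball[OF that] by simp
        then show ?thesis using M norm_triangle_ineq4[of "F m (a + t *s u)" "F n (a + t *s u)"]
          by (smt (verit) g_def mult_minus1 uminus_add_conv_diff add.commute)
      qed
      show "cmod (g t) \<le> \<epsilon>" if "t \<in> ball 0 (4 * \<delta> / R)" for t
      proof -
        have "a + t *s u \<in> ball a \<delta>" using in_ball[OF that] \<open>0 < R\<close> by simp
        from N[OF this \<open>m \<ge> N\<close> \<open>n \<ge> N\<close>] show ?thesis by (simp add: g_def dist_norm)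
      qed
    qed
    moreover have "a + u = y" by (simp add: u_def)
    ultimately show ?thesis using \<open>0 < e\<close> by (simp add: g_def dist_norm)
  qed
  then show "\<exists>M. \<forall>x\<in>ball a (R/4). \<forall>m\<ge>M. \<forall>n\<ge>M. dist (F m x) (F n x) < e" by blast
qed

text \<open>
  The set of points near which the sequence is uniformly Cauchy is open by definition, and
  relatively closed in the ball since convergence spreads to balls whose size depends only on the
  distance to the sphere. As it contains \<open>C\<close>, it is the whole ball.
\<close>

lemma Vitali_several:
  fixes F :: "nat \<Rightarrow> complex^'n \<Rightarrow> complex"
  assumes hol: "\<And>k. holomorphic_several (F k) (ball z r)"
    and M: "\<And>k y. y \<in> ball z r \<Longrightarrow> cmod (F k y) \<le> M"
    and C: "open C" "C \<noteq> {}" "C \<subseteq> ball z r" and lim: "uniform_limit C F f sequentially"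
  shows "\<exists>G. holomorphic_several G (ball z r) \<and> (\<forall>y\<in>ball z r. cmod (G y) \<le> M) \<and> (\<forall>y\<in>C. G y = f y)"
proof -
  define W where "W = {y \<in> ball z r. \<exists>d>0. uniformly_Cauchy_on (ball y d) F}"
  let ?V = "ball z r - W"
  have sub: "uniformly_Cauchy_on T F" if "uniformly_Cauchy_on S F" "T \<subseteq> S" for S T
    using that unfolding uniformly_Cauchy_on_def by (meson subsetD)
  have "C \<subseteq> W"
  proof
    fix y assume "y \<in> C"
    with C obtain d where d: "0 < d" "ball y d \<subseteq> C" by (meson openE)
    have "uniformly_Cauchy_on C F"
      using lim by (meson uniformly_convergent_Cauchy uniformly_convergent_on_def)
    then show "y \<in> W" using d sub \<open>y \<in> C\<close> C unfolding W_def by blast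
  qed
  have "open W"
  proof (subst open_contains_ball, rule ballI)
    fix y assume "y \<in> W"
    then obtain d where d: "0 < d" "uniformly_Cauchy_on (ball y d) F" and y: "y \<in> ball z r"
      unfolding W_def by blast
    obtain s where s: "0 < s" "ball y s \<subseteq> ball z r" using y by (meson openE open_ball)
    have "x \<in> W" if "x \<in> ball y (min d s)" for x
    proof -
      have "ball x (d - dist y x) \<subseteq> ball y d" by (simp add: ball_subset_ball_iff dist_commute)
      then have "uniformly_Cauchy_on (ball x (d - dist y x)) F" using d(2) sub by blast
      moreover have "0 < d - dist y x" "x \<in> ball z r" using that s by auto
      ultimately show ?thesis unfolding W_def by blast
    qed
    then show "\<exists>e>0. ball y e \<subseteq> W" using d s by (intro exI[of _ "min d s"]) auto
  qed
  have "open ?V"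
  proof (subst open_contains_ball, rule ballI)
    fix y assume y: "y \<in> ?V"
    define s where "s = r - dist z y"
    have "0 < s" using y by (simp add: s_def)
    have "ball y (s/8) \<subseteq> ?V"
    proof
      fix x assume x: "x \<in> ball y (s/8)"
      have "dist z x \<le> dist z y + dist y x" by (rule dist_triangle)
      moreover have "dist y x < s/8" using x by simp
      ultimately have dzx: "dist z x < r - 7 * s / 8" using s_def by linarith
      have "x \<notin> W"
      proof
        assume "x \<in> W"
        then obtain d where d: "0 < d" "uniformly_Cauchy_on (ball x d) F" unfolding W_def by blast
        have xz: "ball x (3 / 4 * s) \<subseteq> ball z r"
          using dzx \<open>0 < s\<close> by (simp add: ball_subset_ball_iff dist_commute)
        have "uniformly_Cauchy_on (ball x (3 / 4 * s / 4)) F"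
        proof (rule uniformly_Cauchy_on_larger_ball)
          show "holomorphic_several (F k) (ball x (3 / 4 * s))" for k
            by (rule holomorphic_several_subset[OF hol xz])
          show "cmod (F k u) \<le> M" if "u \<in> ball x (3 / 4 * s)" for k u using M xz that by blast
        qed (use d \<open>0 < s\<close> in auto)
        moreover have "ball y (s/16) \<subseteq> ball x (3 / 4 * s / 4)"
          using x by (simp add: ball_subset_ball_iff)
        ultimately have "uniformly_Cauchy_on (ball y (s/16)) F" by (rule sub)
        then have "y \<in> W" unfolding W_def using y \<open>0 < s\<close> by (auto intro!: exI[of _ "s/16"])
        then show False using y by blast
      qed
      moreover have "x \<in> ball z r" using dzx \<open>0 < s\<close> by simp
      ultimately show "x \<in> ?V" by blast
    qed
    then show "\<exists>e>0. ball y e \<subseteq> ?V" using \<open>0 < s\<close> by (intro exI[of _ "s/8"]) simp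
  qed
  have "W \<inter> ball z r = {} \<or> ?V \<inter> ball z r = {}"
    using connectedD[OF connected_ball \<open>open W\<close> \<open>open ?V\<close>, of z r] by blast
  moreover have "W \<subseteq> ball z r" unfolding W_def by blast
  ultimately have W: "W = ball z r" using C \<open>C \<subseteq> W\<close> by blast
  define G where "G y = lim (\<lambda>k. F k y)" for y
  have lu: "locally_uniform_limit (ball z r) F G"
    unfolding locally_uniform_limit_def
  proof
    fix y assume "y \<in> ball z r"
    then obtain d where d: "0 < d" "uniformly_Cauchy_on (ball y d) F"
      using W unfolding W_def by blast
    then have "uniformly_convergent_on (ball y d) F" by (simp add: Cauchy_uniformly_convergent)
    then have "uniform_limit (ball y d) F G sequentially"
      by (simp add: uniformly_convergent_uniform_limit_iff G_def[abs_def])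
    then show "\<exists>r>0. uniform_limit (ball y r) F G sequentially" using d by blast
  qed
  show ?thesis
  proof (intro exI conjI ballI)
    show "holomorphic_several G (ball z r)"
      using Weierstrass_several(1)[OF open_ball hol lu] .
    have G: "(\<lambda>k. F k y) \<longlonglongrightarrow> G y" if "y \<in> ball z r" for y
      using locally_uniform_limit_tendsto[OF lu that] .
    show "cmod (G y) \<le> M" if "y \<in> ball z r" for y
      by (rule LIMSEQ_le_const2[OF tendsto_norm[OF G[OF that]]]) (use M[OF that] in blast)
    show "G y = f y" if "y \<in> C" for y
      using LIMSEQ_unique[OF G tendsto_uniform_limitI[OF lim that]] C that by blast
  qed
qed

section \<open>Iterated partial derivatives\<close>

text \<open>
  The index set allows properties that relate several functions, or all members of a sequence, to be
  carried through iterated partial derivatives.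
\<close>

lemma mderiv_induct:
  fixes F :: "'i \<Rightarrow> complex^'n \<Rightarrow> complex"
  assumes "P F" and step: "\<And>F j. P F \<Longrightarrow> P (\<lambda>i. cpartial j (F i))"
  shows "P (\<lambda>i. mderiv \<alpha> (F i))"
proof -
  have pow: "P (\<lambda>i. (cpartial j ^^ k) (G i))" if "P G" for j k G
    using that by (induction k) (auto intro: step)
  have "P (\<lambda>i. foldr (\<lambda>j g. (cpartial j ^^ \<alpha> j) g) js (F i))" for js :: "'n list"
    by (induction js) (auto intro: pow \<open>P F\<close>)
  then show ?thesis by (simp add: mderiv_def)
qed

lemma mderiv_zero_index: "mderiv (\<lambda>_. 0) f = f"
proof -
  have "foldr (\<lambda>j g. (cpartial j ^^ 0) g) js f = f" for js :: "'a list"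
    by (induction js) auto
  then show ?thesis by (simp add: mderiv_def)
qed

lemma mi_order_zero: "enat (mi_order (\<lambda>_. 0)) \<le> p"
  by (simp add: mi_order_def flip: zero_enat_def)

lemma eventually_line_in_open:
  assumes "open S" "(z :: complex^'n) \<in> S"
  shows "\<forall>\<^sub>F t in nhds 0. z + t *s u \<in> S"
proof -
  have "((\<lambda>t. z + t *s u) \<longlongrightarrow> z + 0 *s u) (nhds 0)"
    using has_derivative_continuous[OF line_has_derivative[of z u 0]]
      tendsto_at_iff_tendsto_nhds[of "\<lambda>t. z + t *s u" 0]
    by (simp add: continuous_within)
  then show ?thesis using assms by (intro topological_tendstoD) auto
qed

lemma cpartial_cong:
  assumes "open S" "z \<in> S" "\<And>x. x \<in> S \<Longrightarrow> f x = g x"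
  shows "cpartial j f z = cpartial j g z"
  unfolding cpartial_eq_deriv_along_line
proof (rule deriv_cong_ev)
  show "\<forall>\<^sub>F t in nhds 0. f (z + t *s axis j 1) = g (z + t *s axis j 1)"
    using eventually_line_in_open[OF assms(1,2)] by eventually_elim (rule assms(3))
qed simp

lemma cpartial_add_cmult:
  assumes "holomorphic_several f S" "holomorphic_several g S" "z \<in> S"
  shows "cpartial j (\<lambda>z. f z + a * g z) z = cpartial j f z + a * cpartial j g z"
proof -
  obtain L where L: "(f has_derivative L) (at z)" "\<And>c x. L (c *s x) = c * L x"
    using holomorphic_severalE[OF assms(1,3)] by blast
  obtain K where K: "(g has_derivative K) (at z)" "\<And>c x. K (c *s x) = c * K x"
    using holomorphic_severalE[OF assms(2,3)] by blast
  have "((\<lambda>z. f z + a * g z) has_derivative (\<lambda>x. L x + a * K x)) (at z)"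
    using L K by (auto intro!: derivative_eq_intros)
  moreover have "L (c *s x) + a * K (c *s x) = c * (L x + a * K x)" for c x
    by (simp add: L(2) K(2) algebra_simps)
  ultimately have "cpartial j (\<lambda>z. f z + a * g z) z = L (axis j 1) + a * K (axis j 1)"
    by (rule cpartial_eq_derivative)
  then show ?thesis
    by (simp add: cpartial_eq_derivative[OF L] cpartial_eq_derivative[OF K])
qed

lemma mderiv_cong:
  assumes "open S" "\<And>x. x \<in> S \<Longrightarrow> f x = g x" "z \<in> S"
  shows "mderiv \<alpha> f z = mderiv \<alpha> g z"
proof -
  let ?P = "\<lambda>F :: bool \<Rightarrow> complex^'a \<Rightarrow> complex. \<forall>x\<in>S. F False x = F True x"
  have "?P (\<lambda>i. mderiv \<alpha> (if i then g else f))"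
  proof (rule mderiv_induct[where P = ?P])
    show "?P (\<lambda>i. cpartial j (F i))" if "?P F" for F j
      using cpartial_cong[OF \<open>open S\<close>, of _ "F False" "F True"] that by simp
  qed (use assms in simp)
  then show ?thesis using \<open>z \<in> S\<close> by simp
qed

lemma mderiv_add_cmult:
  assumes "open S" "holomorphic_several f S" "holomorphic_several g S" "z \<in> S"
  shows "mderiv \<alpha> (\<lambda>z. f z + a * g z) z = mderiv \<alpha> f z + a * mderiv \<alpha> g z"
proof -
  let ?P = "\<lambda>F :: nat \<Rightarrow> complex^'a \<Rightarrow> complex. holomorphic_several (F 0) S \<and>
      holomorphic_several (F 1) S \<and> (\<forall>x\<in>S. F 2 x = F 0 x + a * F 1 x)"
  let ?F = "\<lambda>i :: nat. if i = 0 then f else if i = 1 then g else (\<lambda>z. f z + a * g z)"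
  have "?P (\<lambda>i. mderiv \<alpha> (?F i))"
  proof (rule mderiv_induct[where P = ?P])
    show "?P (\<lambda>i. cpartial j (F i))" if F: "?P F" for F j
    proof (intro conjI ballI)
      fix x assume "x \<in> S"
      have "cpartial j (F 2) x = cpartial j (\<lambda>z. F 0 z + a * F 1 z) x"
        using F by (intro cpartial_cong[OF \<open>open S\<close> \<open>x \<in> S\<close>]) simp
      also have "\<dots> = cpartial j (F 0) x + a * cpartial j (F 1) x"
        using F \<open>x \<in> S\<close> by (intro cpartial_add_cmult[of _ S]) simp_all
      finally show "cpartial j (F 2) x = cpartial j (F 0) x + a * cpartial j (F 1) x" .
    qed (use F holomorphic_several_cpartial[OF \<open>open S\<close>] in simp_all)
  qed (use assms in simp)
  then show ?thesis using \<open>z \<in> S\<close> by simp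
qed

lemma mderiv_tendsto:
  assumes "open S" "\<And>k. holomorphic_several (s k) S" "locally_uniform_limit S s f" "z \<in> S"
  shows "(\<lambda>k. mderiv \<alpha> (s k) z) \<longlonglongrightarrow> mderiv \<alpha> f z"
proof -
  \<comment> \<open>Index \<open>0\<close> carries the limit, the successors the sequence.\<close>
  let ?P = "\<lambda>F :: nat \<Rightarrow> complex^'a \<Rightarrow> complex. (\<forall>k. holomorphic_several (F k) S) \<and>
      locally_uniform_limit S (\<lambda>k. F (Suc k)) (F 0)"
  let ?F = "case_nat f s"
  have "?P (\<lambda>i. mderiv \<alpha> (?F i))"
  proof (rule mderiv_induct[where P = ?P])
    show "?P ?F"
      using assms Weierstrass_several(1)[OF assms(1-3)] by (auto split: nat.split)
    show "?P (\<lambda>i. cpartial j (F i))" if F: "?P F" for F j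
      using F holomorphic_several_cpartial[OF \<open>open S\<close>]
        Weierstrass_several(2)[OF \<open>open S\<close>, of "\<lambda>k. F (Suc k)" "F 0" j] by simp
  qed
  then have "locally_uniform_limit S (\<lambda>k. mderiv \<alpha> (s k)) (mderiv \<alpha> f)" by simp
  then show ?thesis using \<open>z \<in> S\<close> by (rule locally_uniform_limit_tendsto)
qed

section \<open>The Frechet space of holomorphic functions smooth up to the boundary\<close>

abbreviation ext_mderiv :: "(complex^'n) set \<Rightarrow> ('n \<Rightarrow> nat) \<Rightarrow> (complex^'n \<Rightarrow> complex) \<Rightarrow> complex^'n \<Rightarrow> complex"
  where "ext_mderiv \<Omega> \<alpha> f \<equiv> closure_ext \<Omega> (mderiv \<alpha> f)"

lemma A_spaceD:
  assumes "f \<in> A_space p \<Omega>"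
  shows "z \<notin> \<Omega> \<Longrightarrow> f z = 0" "holomorphic_several f \<Omega>"
  using assms by (simp_all add: A_space_def)

lemma ext_mderiv_on: "z \<in> \<Omega> \<Longrightarrow> ext_mderiv \<Omega> \<alpha> f z = mderiv \<alpha> f z"
  by (simp add: closure_ext_def)

lemma continuous_on_ext_mderiv:
  assumes "f \<in> A_space p \<Omega>" "enat (mi_order \<alpha>) \<le> p"
  shows "continuous_on (closure \<Omega>) (ext_mderiv \<Omega> \<alpha> f)"
proof -
  obtain h where h: "continuous_on (closure \<Omega>) h" "\<And>z. z \<in> \<Omega> \<Longrightarrow> h z = mderiv \<alpha> f z"
    using assms unfolding A_space_def extends_cont_def by blast
  have "ext_mderiv \<Omega> \<alpha> f z = h z" if "z \<in> closure \<Omega>" for z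
    using closure_ext_eq[OF h that] .
  then show ?thesis using h(1) by (simp cong: continuous_on_cong)
qed

context
  fixes \<Omega> :: "(complex^'n) set" and p :: enat
  assumes open_\<Omega>: "open \<Omega>"
begin

lemma ext_mderiv_add_cmult:
  assumes fg: "f \<in> A_space p \<Omega>" "g \<in> A_space p \<Omega>" and \<alpha>: "enat (mi_order \<alpha>) \<le> p"
    and "z \<in> closure \<Omega>"
  shows "ext_mderiv \<Omega> \<alpha> (\<lambda>z. f z + a * g z) z = ext_mderiv \<Omega> \<alpha> f z + a * ext_mderiv \<Omega> \<alpha> g z"
proof (rule closure_ext_eq)
  show "continuous_on (closure \<Omega>) (\<lambda>z. ext_mderiv \<Omega> \<alpha> f z + a * ext_mderiv \<Omega> \<alpha> g z)"
    using fg \<alpha> by (intro continuous_intros continuous_on_ext_mderiv)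
  show "ext_mderiv \<Omega> \<alpha> f z + a * ext_mderiv \<Omega> \<alpha> g z = mderiv \<alpha> (\<lambda>z. f z + a * g z) z"
    if "z \<in> \<Omega>" for z
    using mderiv_add_cmult[OF open_\<Omega> A_spaceD(2)[OF fg(1)] A_spaceD(2)[OF fg(2)] that]
    by (simp add: ext_mderiv_on that)
qed fact

lemma A_space_add_cmult:
  assumes fg: "f \<in> A_space p \<Omega>" "g \<in> A_space p \<Omega>"
  shows "(\<lambda>z. f z + a * g z) \<in> A_space p \<Omega>"
  unfolding A_space_def
proof (intro CollectI conjI allI impI)
  show "holomorphic_several (\<lambda>z. f z + a * g z) \<Omega>"
    using fg by (intro holomorphic_several_cmult_add A_spaceD)
  fix \<alpha> :: "'n \<Rightarrow> nat" assume \<alpha>: "enat (mi_order \<alpha>) \<le> p"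
  show "extends_cont \<Omega> (mderiv \<alpha> (\<lambda>z. f z + a * g z))"
    unfolding extends_cont_def
  proof (intro exI conjI ballI)
    show "continuous_on (closure \<Omega>) (\<lambda>z. ext_mderiv \<Omega> \<alpha> f z + a * ext_mderiv \<Omega> \<alpha> g z)"
      using fg \<alpha> by (intro continuous_intros continuous_on_ext_mderiv)
    show "ext_mderiv \<Omega> \<alpha> f z + a * ext_mderiv \<Omega> \<alpha> g z = mderiv \<alpha> (\<lambda>z. f z + a * g z) z"
      if "z \<in> \<Omega>" for z
      using mderiv_add_cmult[OF open_\<Omega> A_spaceD(2)[OF fg(1)] A_spaceD(2)[OF fg(2)] that]
      by (simp add: ext_mderiv_on that)
  qed
qed (use fg in \<open>simp add: A_spaceD(1)\<close>)

lemma A_space_diff: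
  assumes "f \<in> A_space p \<Omega>" "g \<in> A_space p \<Omega>"
  shows "(\<lambda>z. f z - g z) \<in> A_space p \<Omega>"
  using A_space_add_cmult[OF assms, of "-1"] by simp

lemma ext_mderiv_diff:
  assumes "f \<in> A_space p \<Omega>" "g \<in> A_space p \<Omega>" "enat (mi_order \<alpha>) \<le> p" "z \<in> closure \<Omega>"
  shows "ext_mderiv \<Omega> \<alpha> (\<lambda>z. f z - g z) z = ext_mderiv \<Omega> \<alpha> f z - ext_mderiv \<Omega> \<alpha> g z"
  using ext_mderiv_add_cmult[OF assms, of "-1"] by simp

lemma A_seminorm_bdd:
  assumes "f \<in> A_space p \<Omega>" "enat (mi_order \<alpha>) \<le> p"
  shows "bdd_above (insert 0 ((\<lambda>z. norm (ext_mderiv \<Omega> \<alpha> f z)) ` {z \<in> closure \<Omega>. norm z \<le> real N}))"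
proof -
  have "{z \<in> closure \<Omega>. norm z \<le> real N} = closure \<Omega> \<inter> cball 0 (real N)" by auto
  then have "compact {z \<in> closure \<Omega>. norm z \<le> real N}"
    by (simp add: closed_Int_compact)
  then have "compact ((\<lambda>z. norm (ext_mderiv \<Omega> \<alpha> f z)) ` {z \<in> closure \<Omega>. norm z \<le> real N})"
    using continuous_on_subset[OF continuous_on_ext_mderiv[OF assms], of "{z \<in> closure \<Omega>. norm z \<le> real N}"]
    by (intro compact_continuous_image continuous_on_norm) auto
  then show ?thesis by (simp add: bounded_imp_bdd_above compact_imp_bounded)
qed

lemma A_seminorm_le_iff:
  assumes "f \<in> A_space p \<Omega>" "enat (mi_order \<alpha>) \<le> p" "0 \<le> e"
  shows "A_seminorm \<Omega> \<alpha> N f \<le> e \<longleftrightarrow>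
           (\<forall>z\<in>closure \<Omega>. norm z \<le> real N \<longrightarrow> norm (ext_mderiv \<Omega> \<alpha> f z) \<le> e)"
  unfolding A_seminorm_def using A_seminorm_bdd[OF assms(1,2), of N] assms(3)
  by (subst cSup_le_iff) auto

lemma ext_mderiv_le_A_seminorm:
  assumes "f \<in> A_space p \<Omega>" "enat (mi_order \<alpha>) \<le> p" "z \<in> closure \<Omega>" "norm z \<le> real N"
  shows "norm (ext_mderiv \<Omega> \<alpha> f z) \<le> A_seminorm \<Omega> \<alpha> N f"
  unfolding A_seminorm_def using A_seminorm_bdd[OF assms(1,2), of N] assms(3,4)
  by (intro cSup_upper) auto

lemma A_seminorm_nonneg:
  assumes "f \<in> A_space p \<Omega>" "enat (mi_order \<alpha>) \<le> p"
  shows "0 \<le> A_seminorm \<Omega> \<alpha> N f"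
  unfolding A_seminorm_def using A_seminorm_bdd[OF assms(1,2), of N]
  by (intro cSup_upper) auto

lemma A_seminorm_add_cmult:
  assumes fg: "f \<in> A_space p \<Omega>" "g \<in> A_space p \<Omega>" and \<alpha>: "enat (mi_order \<alpha>) \<le> p"
  shows "A_seminorm \<Omega> \<alpha> N (\<lambda>z. f z + a * g z) \<le> A_seminorm \<Omega> \<alpha> N f + cmod a * A_seminorm \<Omega> \<alpha> N g"
proof (subst A_seminorm_le_iff[OF A_space_add_cmult[OF fg] \<alpha>])
  show "0 \<le> A_seminorm \<Omega> \<alpha> N f + cmod a * A_seminorm \<Omega> \<alpha> N g"
    using A_seminorm_nonneg fg \<alpha> by simp
  show "\<forall>z\<in>closure \<Omega>. norm z \<le> real N \<longrightarrow> norm (ext_mderiv \<Omega> \<alpha> (\<lambda>z. f z + a * g z) z)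
          \<le> A_seminorm \<Omega> \<alpha> N f + cmod a * A_seminorm \<Omega> \<alpha> N g"
  proof (intro ballI impI)
    fix z assume z: "z \<in> closure \<Omega>" "norm z \<le> real N"
    have "norm (ext_mderiv \<Omega> \<alpha> f z + a * ext_mderiv \<Omega> \<alpha> g z)
            \<le> norm (ext_mderiv \<Omega> \<alpha> f z) + cmod a * norm (ext_mderiv \<Omega> \<alpha> g z)"
      using norm_triangle_ineq by (metis norm_mult)
    also have "\<dots> \<le> A_seminorm \<Omega> \<alpha> N f + cmod a * A_seminorm \<Omega> \<alpha> N g"
      using fg \<alpha> z by (intro add_mono mult_left_mono ext_mderiv_le_A_seminorm) auto
    finally show "norm (ext_mderiv \<Omega> \<alpha> (\<lambda>z. f z + a * g z) z)
          \<le> A_seminorm \<Omega> \<alpha> N f + cmod a * A_seminorm \<Omega> \<alpha> N g"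
      using ext_mderiv_add_cmult[OF fg \<alpha> z(1)] by simp
  qed
qed

lemma A_seminorm_diff_commute:
  assumes fg: "f \<in> A_space p \<Omega>" "g \<in> A_space p \<Omega>" and \<alpha>: "enat (mi_order \<alpha>) \<le> p"
  shows "A_seminorm \<Omega> \<alpha> N (\<lambda>z. f z - g z) = A_seminorm \<Omega> \<alpha> N (\<lambda>z. g z - f z)"
proof -
  have "(\<lambda>z. norm (ext_mderiv \<Omega> \<alpha> (\<lambda>z. f z - g z) z)) ` {z \<in> closure \<Omega>. norm z \<le> real N} =
      (\<lambda>z. norm (ext_mderiv \<Omega> \<alpha> (\<lambda>z. g z - f z) z)) ` {z \<in> closure \<Omega>. norm z \<le> real N}"
    using fg \<alpha> by (intro image_cong) (simp_all add: ext_mderiv_diff norm_minus_commute)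
  then show ?thesis by (simp add: A_seminorm_def)
qed

text \<open>
  The derivatives, extended to the closure, converge uniformly on bounded parts of \<open>closure \<Omega>\<close> to
  continuous functions \<open>H \<alpha>\<close>. On \<open>\<Omega>\<close> the Weierstrass theorem identifies \<open>H \<alpha>\<close> with the derivative
  of the limit function \<open>H 0\<close>, so that \<open>H \<alpha>\<close> is its continuous extension.
\<close>

lemma A_space_complete:
  fixes s :: "nat \<Rightarrow> complex^'n \<Rightarrow> complex"
  assumes s: "\<And>n. s n \<in> A_space p \<Omega>"
    and cauchy: "\<And>\<alpha> N e. enat (mi_order \<alpha>) \<le> p \<Longrightarrow> 0 < e \<Longrightarrow>
       \<exists>n0. \<forall>m\<ge>n0. \<forall>n\<ge>n0. A_seminorm \<Omega> \<alpha> N (\<lambda>z. s m z - s n z) < e"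
  shows "\<exists>f\<in>A_space p \<Omega>. \<forall>\<alpha> N. \<forall>e>0. enat (mi_order \<alpha>) \<le> p \<longrightarrow>
       (\<exists>n0. \<forall>n\<ge>n0. A_seminorm \<Omega> \<alpha> N (\<lambda>z. s n z - f z) < e)"
proof -
  define H where "H \<alpha> z = lim (\<lambda>n. ext_mderiv \<Omega> \<alpha> (s n) z)" for \<alpha> z
  have unif: "uniform_limit (closure \<Omega> \<inter> cball 0 (real N)) (\<lambda>n. ext_mderiv \<Omega> \<alpha> (s n)) (H \<alpha>) sequentially"
    if \<alpha>: "enat (mi_order \<alpha>) \<le> p" for \<alpha> N
  proof -
    have "uniformly_Cauchy_on (closure \<Omega> \<inter> cball 0 (real N)) (\<lambda>n. ext_mderiv \<Omega> \<alpha> (s n))"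
      unfolding uniformly_Cauchy_on_def
    proof (intro allI impI)
      fix e :: real assume "0 < e"
      from cauchy[OF \<alpha> this] obtain n0 where
        n0: "\<And>m n. m \<ge> n0 \<Longrightarrow> n \<ge> n0 \<Longrightarrow> A_seminorm \<Omega> \<alpha> N (\<lambda>z. s m z - s n z) < e" by meson
      have "dist (ext_mderiv \<Omega> \<alpha> (s m) z) (ext_mderiv \<Omega> \<alpha> (s n) z) < e"
        if "z \<in> closure \<Omega> \<inter> cball 0 (real N)" "m \<ge> n0" "n \<ge> n0" for z m n
        using ext_mderiv_le_A_seminorm[OF A_space_diff[OF s[of m] s[of n]] \<alpha>, of z N]
          ext_mderiv_diff[OF s[of m] s[of n] \<alpha>, of z] n0[OF that(2,3)] that(1)
        by (simp add: dist_norm)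
      then show "\<exists>M. \<forall>x\<in>closure \<Omega> \<inter> cball 0 (real N). \<forall>m\<ge>M. \<forall>n\<ge>M.
          dist (ext_mderiv \<Omega> \<alpha> (s m) x) (ext_mderiv \<Omega> \<alpha> (s n) x) < e" by blast
    qed
    then show ?thesis
      using Cauchy_uniformly_convergent uniformly_convergent_uniform_limit_iff
      unfolding H_def[abs_def] by blast
  qed
  have H_cont: "continuous_on (closure \<Omega>) (H \<alpha>)" if \<alpha>: "enat (mi_order \<alpha>) \<le> p" for \<alpha>
    unfolding continuous_on_eq_continuous_within
  proof
    fix z assume z: "z \<in> closure \<Omega>"
    obtain N :: nat where N: "norm z < real N" using reals_Archimedean2 by blast
    have "continuous_on (closure \<Omega> \<inter> cball 0 (real N)) (H \<alpha>)"
    proof (rule uniform_limit_theorem[OF always_eventually[OF allI] unif[OF \<alpha>]])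
      show "continuous_on (closure \<Omega> \<inter> cball 0 (real N)) (ext_mderiv \<Omega> \<alpha> (s n))" for n
        by (rule continuous_on_subset[OF continuous_on_ext_mderiv[OF s \<alpha>]]) blast
    qed simp
    then have "continuous (at z within closure \<Omega> \<inter> cball 0 (real N)) (H \<alpha>)"
      using z N by (simp add: continuous_on_eq_continuous_within)
    moreover have "at z within closure \<Omega> \<inter> cball 0 (real N) = at z within closure \<Omega>"
      by (rule at_within_nhd[of z "ball 0 (real N)"]) (use N in auto)
    ultimately show "continuous (at z within closure \<Omega>) (H \<alpha>)" by simp
  qed
  define f where "f z = (if z \<in> \<Omega> then H (\<lambda>_. 0) z else 0)" for z
  have lu: "locally_uniform_limit \<Omega> s f"
    unfolding locally_uniform_limit_def
  proof
    fix z assume "z \<in> \<Omega>"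
    with open_\<Omega> obtain r where r: "0 < r" "ball z r \<subseteq> \<Omega>" by (rule openE)
    obtain N :: nat where N: "norm z + r < real N" using reals_Archimedean2 by blast
    have sub: "ball z r \<subseteq> closure \<Omega> \<inter> cball 0 (real N)"
    proof
      fix x assume x: "x \<in> ball z r"
      then have "norm x < norm z + r"
        using norm_triangle_ineq2[of x z] by (simp add: dist_norm norm_minus_commute)
      then show "x \<in> closure \<Omega> \<inter> cball 0 (real N)" using N x r closure_subset by fastforce
    qed
    have "uniform_limit (ball z r) (\<lambda>n. ext_mderiv \<Omega> (\<lambda>_. 0) (s n)) (H (\<lambda>_. 0)) sequentially"
      by (rule uniform_limit_on_subset[OF unif[OF mi_order_zero] sub])
    then have "uniform_limit (ball z r) s f sequentially"
      by (rule uniform_limit_cong'[THEN iffD1, rotated 2])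
         (use r in \<open>auto simp: closure_ext_def mderiv_zero_index f_def\<close>)
    then show "\<exists>r>0. uniform_limit (ball z r) s f sequentially" using r(1) by blast
  qed
  have H_eq: "H \<alpha> z = mderiv \<alpha> f z" if \<alpha>: "enat (mi_order \<alpha>) \<le> p" and z: "z \<in> \<Omega>" for \<alpha> z
  proof (rule LIMSEQ_unique)
    obtain N :: nat where "norm z < real N" using reals_Archimedean2 by blast
    then have "z \<in> closure \<Omega> \<inter> cball 0 (real N)" using z closure_subset by fastforce
    from tendsto_uniform_limitI[OF unif[OF \<alpha>] this]
    show "(\<lambda>n. mderiv \<alpha> (s n) z) \<longlonglongrightarrow> H \<alpha> z" by (simp add: ext_mderiv_on z)
    show "(\<lambda>n. mderiv \<alpha> (s n) z) \<longlonglongrightarrow> mderiv \<alpha> f z"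
      by (rule mderiv_tendsto[OF open_\<Omega> A_spaceD(2)[OF s] lu z])
  qed
  have f: "f \<in> A_space p \<Omega>"
    unfolding A_space_def
  proof (intro CollectI conjI allI impI)
    show "holomorphic_several f \<Omega>"
      by (rule Weierstrass_several(1)[OF open_\<Omega> A_spaceD(2)[OF s] lu])
    show "extends_cont \<Omega> (mderiv \<alpha> f)" if "enat (mi_order \<alpha>) \<le> p" for \<alpha>
      unfolding extends_cont_def using H_cont H_eq that by blast
  qed (simp add: f_def)
  show ?thesis
  proof (intro bexI[OF _ f] allI impI)
    fix \<alpha> :: "'n \<Rightarrow> nat" and N :: nat and e :: real
    assume "0 < e" and \<alpha>: "enat (mi_order \<alpha>) \<le> p"
    have ext_f: "ext_mderiv \<Omega> \<alpha> f z = H \<alpha> z" if "z \<in> closure \<Omega>" for z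
      by (rule closure_ext_eq[OF H_cont[OF \<alpha>] H_eq[OF \<alpha>] that])
    have "0 < e/2" using \<open>0 < e\<close> by simp
    with unif[OF \<alpha>, of N] obtain n0 where n0: "\<And>n z. n \<ge> n0 \<Longrightarrow> z \<in> closure \<Omega> \<inter> cball 0 (real N) \<Longrightarrow>
        dist (ext_mderiv \<Omega> \<alpha> (s n) z) (H \<alpha> z) < e/2"
      unfolding uniform_limit_iff eventually_sequentially by meson
    have "A_seminorm \<Omega> \<alpha> N (\<lambda>z. s n z - f z) \<le> e/2" if "n \<ge> n0" for n
    proof (subst A_seminorm_le_iff[OF A_space_diff[OF s f] \<alpha>])
      show "\<forall>z\<in>closure \<Omega>. norm z \<le> real N \<longrightarrow> norm (ext_mderiv \<Omega> \<alpha> (\<lambda>z. s n z - f z) z) \<le> e/2"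
      proof (intro ballI impI)
        fix z assume "z \<in> closure \<Omega>" "norm z \<le> real N"
        then show "norm (ext_mderiv \<Omega> \<alpha> (\<lambda>z. s n z - f z) z) \<le> e/2"
          using n0[OF that, of z] by (simp add: ext_mderiv_diff[OF s f \<alpha>] ext_f dist_norm)
      qed
    qed (use \<open>0 < e\<close> in simp)
    then have "\<forall>n\<ge>n0. A_seminorm \<Omega> \<alpha> N (\<lambda>z. s n z - f z) < e"
      using \<open>0 < e\<close> by fastforce
    then show "\<exists>n0. \<forall>n\<ge>n0. A_seminorm \<Omega> \<alpha> N (\<lambda>z. s n z - f z) < e" ..
  qed
qed

lemma completely_metrizable_A_topology: "completely_metrizable_space (A_topology p \<Omega>)"
proof -
  let ?I = "{(\<alpha> :: 'n \<Rightarrow> nat, N :: nat). enat (mi_order \<alpha>) \<le> p}"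
  let ?q = "\<lambda>(\<alpha>, N) f g. A_seminorm \<Omega> \<alpha> N (\<lambda>z. f z - g z)"
  have "completely_metrizable_space (topology_generated_by
          {{y \<in> A_space p \<Omega>. ?q i y x < e} | x i e. x \<in> A_space p \<Omega> \<and> i \<in> ?I \<and> 0 < e})"
  proof (rule completely_metrizable_pseudometric_family)
    have "((\<lambda>_. 0), 0) \<in> ?I" using mi_order_zero by simp
    then show "?I \<noteq> {}" by blast
  next
    fix i f g assume "i \<in> ?I" "f \<in> A_space p \<Omega>" "g \<in> A_space p \<Omega>"
    then show "0 \<le> ?q i f g" by (auto intro!: A_seminorm_nonneg A_space_diff)
  next
    fix i f assume "i \<in> ?I" and f: "f \<in> A_space p \<Omega>"
    then obtain \<alpha> N where i: "i = (\<alpha>, N)" and \<alpha>: "enat (mi_order \<alpha>) \<le> p" by blast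
    have "A_seminorm \<Omega> \<alpha> N (\<lambda>z. f z - f z) \<le> 0"
      using A_seminorm_le_iff[OF A_space_diff[OF f f] \<alpha>, of 0 N] ext_mderiv_diff[OF f f \<alpha>] by simp
    then show "?q i f f = 0"
      using A_seminorm_nonneg[OF A_space_diff[OF f f] \<alpha>, of N] i by simp
  next
    fix i f g assume "i \<in> ?I" "f \<in> A_space p \<Omega>" "g \<in> A_space p \<Omega>"
    then show "?q i f g = ?q i g f" by (auto intro!: A_seminorm_diff_commute)
  next
    fix i f g h
    assume "i \<in> ?I" and f: "f \<in> A_space p \<Omega>" and g: "g \<in> A_space p \<Omega>" and h: "h \<in> A_space p \<Omega>"
    then obtain \<alpha> N where i: "i = (\<alpha>, N)" and \<alpha>: "enat (mi_order \<alpha>) \<le> p" by blast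
    have "A_seminorm \<Omega> \<alpha> N (\<lambda>z. f z - h z) \<le>
        A_seminorm \<Omega> \<alpha> N (\<lambda>z. f z - g z) + A_seminorm \<Omega> \<alpha> N (\<lambda>z. g z - h z)"
      using A_seminorm_add_cmult[OF A_space_diff[OF f g] A_space_diff[OF g h] \<alpha>, of N 1] by simp
    then show "?q i f h \<le> ?q i f g + ?q i g h" using i by simp
  next
    fix f g assume f: "f \<in> A_space p \<Omega>" and g: "g \<in> A_space p \<Omega>"
      and eq0: "\<And>i. i \<in> ?I \<Longrightarrow> ?q i f g = 0"
    show "f = g"
    proof
      fix z
      show "f z = g z"
      proof (cases "z \<in> \<Omega>")
        case True
        obtain N :: nat where N: "norm z \<le> real N" using real_arch_simple by blast
        have "A_seminorm \<Omega> (\<lambda>_. 0) N (\<lambda>z. f z - g z) = 0"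
          using eq0[of "(\<lambda>_. 0, N)"] by (simp add: mi_order_zero)
        then have "norm (ext_mderiv \<Omega> (\<lambda>_. 0) (\<lambda>z. f z - g z) z) \<le> 0"
          using ext_mderiv_le_A_seminorm[OF A_space_diff[OF f g] mi_order_zero _ N] True closure_subset
          by fastforce
        then show ?thesis by (simp add: closure_ext_def True mderiv_zero_index)
      qed (use f g in \<open>simp add: A_spaceD(1)\<close>)
    qed
  next
    fix s :: "nat \<Rightarrow> complex^'n \<Rightarrow> complex"
    assume s: "range s \<subseteq> A_space p \<Omega>"
      and cauchy: "\<And>i e. i \<in> ?I \<Longrightarrow> 0 < e \<Longrightarrow> \<exists>N. \<forall>m\<ge>N. \<forall>n\<ge>N. ?q i (s m) (s n) < e"
    have "\<exists>f\<in>A_space p \<Omega>. \<forall>\<alpha> N. \<forall>e>0. enat (mi_order \<alpha>) \<le> p \<longrightarrow>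
       (\<exists>n0. \<forall>n\<ge>n0. A_seminorm \<Omega> \<alpha> N (\<lambda>z. s n z - f z) < e)"
    proof (rule A_space_complete)
      show "s n \<in> A_space p \<Omega>" for n using s by blast
      show "\<exists>n0. \<forall>m\<ge>n0. \<forall>n\<ge>n0. A_seminorm \<Omega> \<alpha> N (\<lambda>z. s m z - s n z) < e"
        if "enat (mi_order \<alpha>) \<le> p" "0 < e" for \<alpha> N e
        using cauchy[of "(\<alpha>, N)" e] that by simp
    qed
    then show "\<exists>f\<in>A_space p \<Omega>. \<forall>i\<in>?I. \<forall>e>0. \<exists>N. \<forall>n\<ge>N. ?q i (s n) f < e"
      by (simp add: split_paired_all split_beta) meson
  qed
  moreover have "{{y \<in> A_space p \<Omega>. ?q i y x < e} | x i e. x \<in> A_space p \<Omega> \<and> i \<in> ?I \<and> 0 < e} =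
      {{g \<in> A_space p \<Omega>. A_seminorm \<Omega> \<alpha> N (\<lambda>z. g z - f z) < e} | f \<alpha> N e.
        f \<in> A_space p \<Omega> \<and> enat (mi_order \<alpha>) \<le> p \<and> 0 < e}"
    by (simp only: split_paired_Ex split_conv mem_Collect_eq) 
  ultimately show ?thesis by (simp add: A_topology_def)
qed

text \<open>
  Small scalar multiples of \<open>g\<close> are small in every seminorm. This is how a function with a pole enters
  the neighbourhoods of an arbitrary \<open>f\<close>.
\<close>

lemma A_topology_absorbs:
  assumes "openin (A_topology p \<Omega>) U" "f \<in> U" and g: "g \<in> A_space p \<Omega>"
  shows "\<exists>\<delta>>0. \<forall>t. cmod t < \<delta> \<longrightarrow> (\<lambda>z. f z + t * g z) \<in> U"
proof -
  have "generate_topology_on {{g \<in> A_space p \<Omega>. A_seminorm \<Omega> \<alpha> N (\<lambda>z. g z - f z) < e} | f \<alpha> N e.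
      f \<in> A_space p \<Omega> \<and> enat (mi_order \<alpha>) \<le> p \<and> 0 < e} U"
    using assms(1) unfolding A_topology_def by (rule openin_topology_generated_by)
  then show ?thesis using \<open>f \<in> U\<close>
  proof (induction arbitrary: f rule: generate_topology_on.induct)
    case (Int U V)
    from Int.prems have "f \<in> U" "f \<in> V" by simp_all
    from Int.IH(1)[OF this(1)] obtain d where
      d: "0 < d" "\<forall>t. cmod t < d \<longrightarrow> (\<lambda>z. f z + t * g z) \<in> U" by (elim exE conjE)
    from Int.IH(2)[OF \<open>f \<in> V\<close>] obtain e where
      e: "0 < e" "\<forall>t. cmod t < e \<longrightarrow> (\<lambda>z. f z + t * g z) \<in> V" by (elim exE conjE)
    show ?case using d e by (intro exI[of _ "min d e"]) simp
  next
    case (UN K)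
    from UN.prems obtain U where "U \<in> K" "f \<in> U" by blast
    from UN.IH[OF this] obtain d where
      "0 < d" "\<forall>t. cmod t < d \<longrightarrow> (\<lambda>z. f z + t * g z) \<in> U" by (elim exE conjE)
    then show ?case using \<open>U \<in> K\<close> by (intro exI[of _ d]) blast
  next
    case (Basis B)
    then obtain f0 \<alpha> N e where B: "B = {g \<in> A_space p \<Omega>. A_seminorm \<Omega> \<alpha> N (\<lambda>z. g z - f0 z) < e}"
      and f0: "f0 \<in> A_space p \<Omega>" and \<alpha>: "enat (mi_order \<alpha>) \<le> p" by blast
    have f: "f \<in> A_space p \<Omega>" and less: "A_seminorm \<Omega> \<alpha> N (\<lambda>z. f z - f0 z) < e"
      using Basis B by auto
    define \<delta> where "\<delta> = (e - A_seminorm \<Omega> \<alpha> N (\<lambda>z. f z - f0 z)) / (A_seminorm \<Omega> \<alpha> N g + 1)"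
    have g0: "0 \<le> A_seminorm \<Omega> \<alpha> N g" using A_seminorm_nonneg[OF g \<alpha>] .
    show ?case
    proof (intro exI conjI allI impI)
      show "0 < \<delta>" unfolding \<delta>_def using less g0 by simp
      fix t assume t: "cmod t < \<delta>"
      have "A_seminorm \<Omega> \<alpha> N (\<lambda>z. (f z + t * g z) - f0 z) \<le>
          A_seminorm \<Omega> \<alpha> N (\<lambda>z. f z - f0 z) + cmod t * A_seminorm \<Omega> \<alpha> N g"
        using A_seminorm_add_cmult[OF A_space_diff[OF f f0] g \<alpha>, of N t] by (simp add: algebra_simps)
      also have "cmod t * A_seminorm \<Omega> \<alpha> N g \<le> cmod t * (A_seminorm \<Omega> \<alpha> N g + 1)"
        by (intro mult_left_mono) auto
      also have "\<dots> < \<delta> * (A_seminorm \<Omega> \<alpha> N g + 1)"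
        using t g0 by (intro mult_strict_right_mono) auto
      also have "\<dots> = e - A_seminorm \<Omega> \<alpha> N (\<lambda>z. f z - f0 z)"
        unfolding \<delta>_def using g0 by simp
      finally show "(\<lambda>z. f z + t * g z) \<in> B"
        using A_space_add_cmult[OF f g] B by simp
    qed
  qed simp
qed

end

section \<open>Functions with a pole along a complex hyperplane\<close>

lemma cinner_add_smult: "cinner (z + t *s u) v = cinner z v + t * cinner u v"
  by (simp add: cinner_def sum_distrib_left sum.distrib algebra_simps)

lemma cinner_smult: "cinner (t *s u) v = t * cinner u v"
  by (simp add: cinner_def sum_distrib_left algebra_simps)

lemma cinner_diff_left: "cinner (z - w) v = cinner z v - cinner w v"
  by (simp add: cinner_def sum_subtractf algebra_simps)

lemma bounded_linear_cinner_left: "bounded_linear (\<lambda>z. cinner z (v :: complex^'n))"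
  unfolding cinner_def
  by (intro bounded_linear_sum bounded_linear_mult_const bounded_linear_vec_nth)

text \<open>Hence the complex hyperplanes orthogonal to \<open>v\<close> lie in real ones, which convexity provides.\<close>

lemma Re_cinner: "Re (cinner z v) = z \<bullet> v"
  by (simp add: cinner_def inner_vec_def inner_complex_def)

definition reciprocal_on ::
    "(complex^'n) set \<Rightarrow> complex^'n \<Rightarrow> complex^'n \<Rightarrow> complex^'n \<Rightarrow> complex" where
  "reciprocal_on \<Omega> w v z = (if z \<in> \<Omega> then inverse (cinner z v - cinner w v) else 0)"

text \<open>
  On \<open>\<Omega>\<close> every iterated partial derivative is a multiple of a power of the function itself, and these
  powers are continuous on \<open>closure \<Omega>\<close>, where the denominator does not vanish.
\<close>

lemma reciprocal_on_in_A_space: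
  fixes \<Omega> :: "(complex^'n) set"
  assumes "open \<Omega>" and nz: "\<And>z. z \<in> closure \<Omega> \<Longrightarrow> cinner z v \<noteq> cinner w v"
  shows "reciprocal_on \<Omega> w v \<in> A_space p \<Omega>"
proof -
  define d where "d z = cinner z v - cinner w v" for z
  have d_nz: "d z \<noteq> 0" if "z \<in> closure \<Omega>" for z using nz[OF that] by (simp add: d_def)
  have d_nz': "d z \<noteq> 0" if "z \<in> \<Omega>" for z using d_nz that closure_subset by blast
  have d_deriv: "(d has_derivative (\<lambda>h. cinner h v)) (at z)" for z
    unfolding d_def[abs_def] using bounded_linear.has_derivative[OF bounded_linear_cinner_left has_derivative_ident]
    by (auto intro!: derivative_eq_intros)
  let ?P = "\<lambda>f. \<exists>c m. \<forall>z\<in>\<Omega>. f z = c * inverse (d z) ^ m"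
  have mderiv: "?P (mderiv \<alpha> (reciprocal_on \<Omega> w v))" for \<alpha>
  proof (rule mderiv_induct[where P = "\<lambda>F. ?P (F ())" and F = "\<lambda>_. reciprocal_on \<Omega> w v"])
    show "?P (reciprocal_on \<Omega> w v)"
      by (rule exI[of _ 1], rule exI[of _ 1]) (simp add: reciprocal_on_def d_def)
  next
    fix F :: "unit \<Rightarrow> complex^'n \<Rightarrow> complex" and j assume "?P (F ())"
    then obtain c m where F: "\<And>z. z \<in> \<Omega> \<Longrightarrow> F () z = c * inverse (d z) ^ m" by blast
    define b where "b = cinner (axis j 1) v"
    \<comment> \<open>The exponent is \<open>m + 1\<close> if \<open>m > 0\<close>; for \<open>m = 0\<close>, where \<open>m - 1\<close> is truncated, the factor \<open>of_nat m\<close> vanishes.\<close>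
    have "cpartial j (F ()) z = (- c * of_nat m * b) * inverse (d z) ^ (m - 1 + 2)" if z: "z \<in> \<Omega>" for z
    proof -
      have "cpartial j (F ()) z = cpartial j (\<lambda>z. c * inverse (d z) ^ m) z"
        by (rule cpartial_cong[OF \<open>open \<Omega>\<close> z F])
      also have "\<dots> = deriv (\<lambda>t. c * inverse (d z + t * b) ^ m) 0"
        by (simp add: cpartial_eq_deriv_along_line d_def cinner_add_smult b_def algebra_simps)
      also have "\<dots> = (- c * of_nat m * b) * inverse (d z) ^ (m - 1 + 2)"
      proof (rule DERIV_imp_deriv)
        show "((\<lambda>t. c * inverse (d z + t * b) ^ m) has_field_derivative
            (- c * of_nat m * b) * inverse (d z) ^ (m - 1 + 2)) (at 0)"
          using d_nz'[OF z]
          by (auto intro!: derivative_eq_intros simp: power_add power2_eq_square algebra_simps)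
      qed
      finally show ?thesis .
    qed
    then show "?P (cpartial j (F ()))" by blast
  qed
  show ?thesis
    unfolding A_space_def
  proof (intro CollectI conjI allI impI)
    show "holomorphic_several (reciprocal_on \<Omega> w v) \<Omega>"
      unfolding holomorphic_several_def
    proof
      fix z assume z: "z \<in> \<Omega>"
      let ?L = "\<lambda>h. - (inverse (d z) * cinner h v * inverse (d z))"
      have "((\<lambda>z. inverse (d z)) has_derivative ?L) (at z)"
        using d_nz'[OF z] by (rule Deriv.has_derivative_inverse[OF _ d_deriv])
      then have "(reciprocal_on \<Omega> w v has_derivative ?L) (at z)"
        by (rule has_derivative_transform_within_open[OF _ \<open>open \<Omega>\<close> z])
           (simp add: reciprocal_on_def d_def)
      then show "\<exists>L. (reciprocal_on \<Omega> w v has_derivative L) (at z) \<and> (\<forall>c x. L (c *s x) = c * L x)"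
        by (intro exI[of _ ?L]) (simp add: cinner_smult)
    qed
    have "isCont d z" for z by (rule has_derivative_continuous[OF d_deriv])
    then have "continuous_on (closure \<Omega>) d" by (simp add: continuous_at_imp_continuous_on)
    then have cont: "continuous_on (closure \<Omega>) (\<lambda>z. c * inverse (d z) ^ m)" for c m
      by (intro continuous_intros) (use d_nz in auto)
    show "extends_cont \<Omega> (mderiv \<alpha> (reciprocal_on \<Omega> w v))" for \<alpha>
    proof -
      obtain c m where "\<forall>z\<in>\<Omega>. mderiv \<alpha> (reciprocal_on \<Omega> w v) z = c * inverse (d z) ^ m"
        using mderiv by blast
      then show ?thesis
        unfolding extends_cont_def by (intro exI[of _ "\<lambda>z. c * inverse (d z) ^ m"]) (simp add: cont)
    qed
  qed (simp add: reciprocal_on_def)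
qed

text \<open>
  On the complex line from a point \<open>x\<close> of \<open>C\<close> to \<open>w\<close> the product of \<open>G\<close> with the denominator is
  \<open>1\<close> near \<open>x\<close>, hence on the whole intersection of the line with the ball, which is convex; but it
  vanishes at \<open>w\<close>.
\<close>

lemma reciprocal_not_extendable:
  fixes G :: "complex^'n \<Rightarrow> complex"
  assumes G: "holomorphic_several G (ball \<zeta> r)" and w: "w \<in> ball \<zeta> r"
    and C: "open C" "C \<noteq> {}" "C \<subseteq> ball \<zeta> r"
    and eq: "\<And>z. z \<in> C \<Longrightarrow> G z = inverse (cinner z v - cinner w v)"
    and nz: "\<And>z. z \<in> C \<Longrightarrow> cinner z v \<noteq> cinner w v"
  shows False
proof -
  obtain x where x: "x \<in> C" using C by blast
  define u where "u = w - x"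
  define T where "T = {t. x + t *s u \<in> ball \<zeta> r}"
  define T' where "T' = {t. x + t *s u \<in> C}"
  have cont: "continuous_on UNIV (\<lambda>t. x + t *s u)"
    using has_derivative_continuous[OF line_has_derivative]
    by (intro continuous_at_imp_continuous_on ballI)
  have "open T" "open T'"
    using open_vimage[OF open_ball cont, of \<zeta> r] open_vimage[OF \<open>open C\<close> cont]
    by (simp_all add: T_def T'_def vimage_def)
  have "convex T"
  proof (rule convexI)
    fix s t and a b :: real
    assume st: "s \<in> T" "t \<in> T" and ab: "0 \<le> a" "0 \<le> b" "a + b = 1"
    have "x + (a *\<^sub>R s + b *\<^sub>R t) *s u = (a + b) *\<^sub>R x + (a *\<^sub>R (s *s u) + b *\<^sub>R (t *s u))"
      using ab by (simp add: vec_eq_iff algebra_simps)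
    also have "\<dots> = a *\<^sub>R (x + s *s u) + b *\<^sub>R (x + t *s u)"
      by (simp add: algebra_simps)
    also have "\<dots> \<in> ball \<zeta> r"
      using st ab by (intro convexD[OF convex_ball]) (auto simp: T_def)
    finally show "a *\<^sub>R s + b *\<^sub>R t \<in> T" by (simp add: T_def)
  qed
  define \<phi> where "\<phi> t = G (x + t *s u) * (cinner x v - cinner w v + t * cinner u v)" for t
  have "\<phi> 1 = 1"
  proof (rule analytic_continuation_open[of T' T \<phi> "\<lambda>_. 1"])
    show "T' \<noteq> {}" using x by (auto simp: T'_def intro!: exI[of _ 0])
    show "T' \<subseteq> T" using C by (auto simp: T_def T'_def)
    have "(\<lambda>t. G (x + t *s u)) holomorphic_on T"
      by (rule holomorphic_several_along_line[OF G]) (simp add: T_def)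
    then show "\<phi> holomorphic_on T"
      unfolding \<phi>_def[abs_def] by (intro holomorphic_intros)
    show "\<phi> t = 1" if "t \<in> T'" for t
    proof -
      have C: "x + t *s u \<in> C" using that by (simp add: T'_def)
      have "cinner x v - cinner w v + t * cinner u v = cinner (x + t *s u) v - cinner w v"
        by (simp add: cinner_add_smult)
      then have "\<phi> t = inverse (cinner (x + t *s u) v - cinner w v) * (cinner (x + t *s u) v - cinner w v)"
        by (simp only: \<phi>_def eq[OF C])
      also have "\<dots> = 1" using nz[OF C] by (intro left_inverse) simp
      finally show ?thesis .
    qed
    show "1 \<in> T" using w by (simp add: T_def u_def)
  qed (use \<open>open T\<close> \<open>open T'\<close> \<open>convex T\<close> convex_connected in auto)
  moreover have "\<phi> 1 = 0" by (simp add: \<phi>_def u_def cinner_diff_left)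
  ultimately show False by simp
qed

section \<open>Bounded extensions form closed nowhere dense sets\<close>

definition boundedly_extendable ::
    "enat \<Rightarrow> (complex^'n) set \<Rightarrow> complex^'n \<Rightarrow> real \<Rightarrow> (complex^'n) set \<Rightarrow> real \<Rightarrow> (complex^'n \<Rightarrow> complex) set"
  where "boundedly_extendable p \<Omega> \<zeta> r C M = {f \<in> A_space p \<Omega>. \<exists>F. holomorphic_several F (ball \<zeta> r) \<and>
      (\<forall>z\<in>ball \<zeta> r. cmod (F z) \<le> M) \<and> (\<forall>z\<in>C. F z = f z)}"

text \<open>
  A function in the closure is, on the bounded set \<open>C\<close>, a uniform limit of members of the set, because
  the seminorm of order \<open>0\<close> dominates the supremum over \<open>C\<close>. Their extensions have the common bound
  \<open>M\<close>, and Vitali's theorem provides the extension of the limit.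
\<close>

lemma closedin_boundedly_extendable:
  fixes \<Omega> :: "(complex^'n) set"
  assumes "open \<Omega>" and C: "open C" "C \<noteq> {}" "C \<subseteq> ball \<zeta> r" "C \<subseteq> \<Omega>"
  shows "closedin (A_topology p \<Omega>) (boundedly_extendable p \<Omega> \<zeta> r C M)"
    (is "closedin _ ?E")
  unfolding closedin_def topspace_A_topology
proof
  show "?E \<subseteq> A_space p \<Omega>" by (auto simp: boundedly_extendable_def)
  show "openin (A_topology p \<Omega>) (A_space p \<Omega> - ?E)"
  proof (subst openin_subopen, rule ballI)
    fix f assume f: "f \<in> A_space p \<Omega> - ?E"
    then have fA: "f \<in> A_space p \<Omega>" by blast
    obtain N :: nat where N: "norm \<zeta> + r \<le> real N" using real_arch_simple by blast
    define U where "U k = {g \<in> A_space p \<Omega>. A_seminorm \<Omega> (\<lambda>_. 0) N (\<lambda>z. g z - f z) < inverse (real (Suc k))}" for k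
    have U_open: "openin (A_topology p \<Omega>) (U k)" for k
      unfolding A_topology_def
    proof (rule topology_generated_by_Basis)
      have "0 < inverse (real (Suc k))" by simp
      then show "U k \<in> {{g \<in> A_space p \<Omega>. A_seminorm \<Omega> \<alpha> N (\<lambda>z. g z - f z) < e} | f \<alpha> N e.
          f \<in> A_space p \<Omega> \<and> enat (mi_order \<alpha>) \<le> p \<and> 0 < e}"
        unfolding U_def using fA mi_order_zero by blast
    qed
    have "A_seminorm \<Omega> (\<lambda>_. 0) N (\<lambda>z. f z - f z) \<le> 0"
      using A_seminorm_le_iff[OF \<open>open \<Omega>\<close> A_space_diff[OF \<open>open \<Omega>\<close> fA fA] mi_order_zero, of 0 N]
        ext_mderiv_diff[OF \<open>open \<Omega>\<close> fA fA mi_order_zero] by simp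
    then have fU: "f \<in> U k" for k
      unfolding U_def using fA by (simp add: order_le_less_trans)
    have "\<exists>k. U k \<inter> ?E = {}"
    proof (rule ccontr)
      assume "\<nexists>k. U k \<inter> ?E = {}"
      then have "\<forall>k. \<exists>g F. g \<in> U k \<and> holomorphic_several F (ball \<zeta> r) \<and>
          (\<forall>z\<in>ball \<zeta> r. cmod (F z) \<le> M) \<and> (\<forall>z\<in>C. F z = g z)"
        unfolding boundedly_extendable_def by blast
      then obtain g F where gF: "\<And>k. g k \<in> U k" "\<And>k. holomorphic_several (F k) (ball \<zeta> r)"
          "\<And>k z. z \<in> ball \<zeta> r \<Longrightarrow> cmod (F k z) \<le> M" "\<And>k z. z \<in> C \<Longrightarrow> F k z = g k z"
        by metis
      have "uniform_limit C F f sequentially"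
        unfolding uniform_limit_iff
      proof (intro allI impI)
        fix e :: real assume "0 < e"
        have "\<forall>\<^sub>F k in sequentially. inverse (real (Suc k)) < e"
          by (rule order_tendstoD(2)[OF LIMSEQ_inverse_real_of_nat \<open>0 < e\<close>])
        then show "\<forall>\<^sub>F k in sequentially. \<forall>z\<in>C. dist (F k z) (f z) < e"
        proof eventually_elim
          case (elim k)
          show ?case
          proof
            fix z assume z: "z \<in> C"
            then have "dist \<zeta> z < r" "z \<in> \<Omega>" using C by auto
            then have "norm z \<le> real N"
              using N norm_triangle_ineq2[of z \<zeta>] by (simp add: dist_norm norm_minus_commute)
            have gA: "g k \<in> A_space p \<Omega>" using gF(1)[of k] by (simp add: U_def)
            have "norm (ext_mderiv \<Omega> (\<lambda>_. 0) (\<lambda>z. g k z - f z) z) \<le> A_seminorm \<Omega> (\<lambda>_. 0) N (\<lambda>z. g k z - f z)"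
              using closure_subset \<open>z \<in> \<Omega>\<close> \<open>norm z \<le> real N\<close>
              by (intro ext_mderiv_le_A_seminorm[OF \<open>open \<Omega>\<close> A_space_diff[OF \<open>open \<Omega>\<close> gA fA] mi_order_zero]) auto
            also have "\<dots> < inverse (real (Suc k))" using gF(1)[of k] by (simp add: U_def)
            also have "\<dots> < e" by (rule elim)
            finally show "dist (F k z) (f z) < e"
              using \<open>z \<in> \<Omega>\<close> gF(4)[OF z, of k] by (simp add: closure_ext_def mderiv_zero_index dist_norm)
          qed
        qed
      qed
      from Vitali_several[OF gF(2,3) C(1-3) this] have "f \<in> ?E"
        using fA by (auto simp: boundedly_extendable_def)
      then show False using f by blast
    qed
    then obtain k where "U k \<inter> ?E = {}" ..
    moreover have "U k \<subseteq> A_space p \<Omega>" by (auto simp: U_def)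
    ultimately show "\<exists>V. openin (A_topology p \<Omega>) V \<and> f \<in> V \<and> V \<subseteq> A_space p \<Omega> - ?E"
      using U_open fU by (intro exI[of _ "U k"]) blast
  qed
qed

text \<open>
  If the set were a neighbourhood of \<open>f\<close>, it would also contain \<open>f + t g\<close> for the function \<open>g\<close> with
  a pole at a nearby \<open>w\<close> and a small \<open>t \<noteq> 0\<close>; the difference of the two extensions divided by \<open>t\<close>
  would extend \<open>g\<close> across \<open>w\<close>.
\<close>

lemma interior_boundedly_extendable:
  fixes \<Omega> :: "(complex^'n) set"
  assumes star: "star_condition \<Omega>" and \<zeta>: "\<zeta> \<in> frontier \<Omega>" and "0 < r"
    and C: "open C" "C \<noteq> {}" "C \<subseteq> ball \<zeta> r" "C \<subseteq> \<Omega>"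
  shows "A_topology p \<Omega> interior_of boundedly_extendable p \<Omega> \<zeta> r C M = {}"
    (is "_ interior_of ?E = {}")
proof (rule ccontr)
  assume "A_topology p \<Omega> interior_of ?E \<noteq> {}"
  then obtain U f where U: "openin (A_topology p \<Omega>) U" "f \<in> U" "U \<subseteq> ?E"
    unfolding interior_of_def by blast
  have "open \<Omega>" using star by (simp add: star_condition_def)
  obtain w v where w: "dist w \<zeta> < r" and disj: "{z. cinner z v = cinner w v} \<inter> closure \<Omega> = {}"
    using star \<zeta> \<open>0 < r\<close> unfolding star_condition_def by meson
  have nz: "cinner z v \<noteq> cinner w v" if "z \<in> closure \<Omega>" for z using disj that by blast
  let ?g = "reciprocal_on \<Omega> w v"
  have g: "?g \<in> A_space p \<Omega>" using \<open>open \<Omega>\<close> nz by (rule reciprocal_on_in_A_space)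
  obtain \<delta> where \<delta>: "0 < \<delta>" "\<forall>t. cmod t < \<delta> \<longrightarrow> (\<lambda>z. f z + t * ?g z) \<in> U"
    using A_topology_absorbs[OF \<open>open \<Omega>\<close> U(1,2) g] by (elim exE conjE)
  define t where "t = complex_of_real (\<delta> / 2)"
  have "t \<noteq> 0" "cmod t < \<delta>" using \<delta>(1) by (simp_all add: t_def)
  have "f \<in> ?E" "(\<lambda>z. f z + t * ?g z) \<in> ?E" using U \<delta> \<open>cmod t < \<delta>\<close> by auto
  then obtain F F' where F: "holomorphic_several F (ball \<zeta> r)" "\<And>z. z \<in> C \<Longrightarrow> F z = f z"
    and F': "holomorphic_several F' (ball \<zeta> r)" "\<And>z. z \<in> C \<Longrightarrow> F' z = f z + t * ?g z"
    unfolding boundedly_extendable_def by blast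
  have 0: "holomorphic_several (\<lambda>z. 0) (ball \<zeta> r)"
    unfolding holomorphic_several_def by (intro ballI exI[of _ "\<lambda>_. 0"]) auto
  show False
  proof (rule reciprocal_not_extendable[where G = "\<lambda>z. 0 + inverse t * (F' z + (-1) * F z)"])
    show "holomorphic_several (\<lambda>z. 0 + inverse t * (F' z + (-1) * F z)) (ball \<zeta> r)"
      by (intro holomorphic_several_cmult_add 0 F F')
    show "w \<in> ball \<zeta> r" using w by (simp add: dist_commute)
    show "0 + inverse t * (F' z + (-1) * F z) = inverse (cinner z v - cinner w v)" if "z \<in> C" for z
    proof -
      have "z \<in> \<Omega>" using that C by blast
      then show ?thesis using \<open>t \<noteq> 0\<close> by (simp add: F(2)[OF that] F'(2)[OF that] reciprocal_on_def)
    qed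
    show "cinner z v \<noteq> cinner w v" if "z \<in> C" for z
      using nz that C closure_subset by blast
  qed (use C in auto)
qed

section \<open>Extendability as a countable union\<close>

definition extendability_pieces ::
    "enat \<Rightarrow> (complex^'n) set \<Rightarrow> complex^'n \<Rightarrow> (complex^'n \<Rightarrow> complex) set set" where
  "extendability_pieces p \<Omega> \<zeta> = {boundedly_extendable p \<Omega> \<zeta> r C (real M) | r C M.
     r \<in> \<rat> \<and> 0 < r \<and> C \<in> components (ball \<zeta> r \<inter> \<Omega>)}"

lemma countable_components_open:
  fixes S :: "'a::euclidean_space set"
  assumes "open S"
  shows "countable (components S)"
proof (rule countable_disjoint_open_subsets)
  show "open C" if "C \<in> components S" for C using assms that by (rule open_components)
  show "pairwise disjnt (components S)"
    using pairwise_disjoint_components[of S] by (simp add: pairwise_def disjnt_def)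
qed

lemma countable_extendability_pieces:
  assumes "open \<Omega>"
  shows "countable (extendability_pieces p \<Omega> \<zeta>)"
proof -
  let ?I = "(SIGMA r:\<rat>. components (ball \<zeta> r \<inter> \<Omega>) \<times> (UNIV :: nat set))"
  have "extendability_pieces p \<Omega> \<zeta> \<subseteq> (\<lambda>(r, C, M). boundedly_extendable p \<Omega> \<zeta> r C (real M)) ` ?I"
    unfolding extendability_pieces_def by (auto simp: image_iff)
  moreover have "countable ?I"
    using assms by (intro countable_SIGMA countable_rat countable_components_open) auto
  ultimately show ?thesis by (meson countable_image countable_subset)
qed

text \<open>
  This carries extendability from a component over to a smaller ball that still meets the component.
\<close>

lemma component_nested:
  assumes C: "C \<in> components (B \<inter> \<Omega>)" and x: "x \<in> C" "x \<in> B'" and "B' \<subseteq> B"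
  obtains C' where "C' \<in> components (B' \<inter> \<Omega>)" "C' \<subseteq> C"
proof -
  have "x \<in> B' \<inter> \<Omega>" using in_components_subset[OF C] x by blast
  then obtain C' where C': "C' \<in> components (B' \<inter> \<Omega>)" "x \<in> C'"
    by (metis componentsI connected_component_refl mem_Collect_eq)
  have "C' \<subseteq> C"
    using in_components_subset[OF C'(1)] in_components_connected[OF C'(1)] C' x \<open>B' \<subseteq> B\<close>
    by (intro components_maximal[OF C]) auto
  with C'(1) show ?thesis by (rule that)
qed

text \<open>
  The component \<open>C\<close> may stay away from \<open>\<zeta>\<close>, so the rational radius has to be taken between the distance
  of \<open>\<zeta>\<close> to a point of \<open>C\<close> and \<open>r\<close>. On the smaller ball the extension is bounded by compactness.
\<close>

lemma Union_extendability_pieces: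
  fixes \<Omega> :: "(complex^'n) set"
  shows "\<Union>(extendability_pieces p \<Omega> \<zeta>) = {f \<in> A_space p \<Omega>. extendable_at \<Omega> f \<zeta>}"
proof (intro set_eqI iffI)
  fix f assume "f \<in> \<Union>(extendability_pieces p \<Omega> \<zeta>)"
  then show "f \<in> {f \<in> A_space p \<Omega>. extendable_at \<Omega> f \<zeta>}"
    unfolding extendability_pieces_def boundedly_extendable_def extendable_at_def by blast
next
  fix f assume "f \<in> {f \<in> A_space p \<Omega>. extendable_at \<Omega> f \<zeta>}"
  then obtain r F C where f: "f \<in> A_space p \<Omega>" and F: "holomorphic_several F (ball \<zeta> r)"
    and C: "C \<in> components (ball \<zeta> r \<inter> \<Omega>)" and eq: "\<forall>z\<in>C. F z = f z"
    unfolding extendable_at_def by blast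
  obtain x where x: "x \<in> C" using in_components_nonempty[OF C] by blast
  then have "dist \<zeta> x < r" using in_components_subset[OF C] by auto
  then obtain q where q: "q \<in> \<rat>" "dist \<zeta> x < q" "q < r" using Rats_dense_in_real by blast
  obtain C' where C': "C' \<in> components (ball \<zeta> q \<inter> \<Omega>)" "C' \<subseteq> C"
    using component_nested[OF C x, of "ball \<zeta> q"] q by (auto simp: subset_ball)
  have "cball \<zeta> q \<subseteq> ball \<zeta> r" using q by auto
  then have "continuous_on (cball \<zeta> q) F"
    using holomorphic_several_imp_continuous_on[OF F] continuous_on_subset by blast
  then have "bounded (F ` cball \<zeta> q)"
    by (intro compact_imp_bounded compact_continuous_image compact_cball)
  then obtain M where M: "\<forall>y\<in>F ` cball \<zeta> q. cmod y \<le> M" unfolding bounded_iff ..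
  obtain K :: nat where K: "M \<le> real K" using real_arch_simple by blast
  have "f \<in> boundedly_extendable p \<Omega> \<zeta> q C' (real K)"
    unfolding boundedly_extendable_def
  proof (intro CollectI conjI exI[of _ F] ballI f)
    show "holomorphic_several F (ball \<zeta> q)"
      by (rule holomorphic_several_subset[OF F]) (use q in \<open>simp add: subset_ball\<close>)
    show "cmod (F z) \<le> real K" if "z \<in> ball \<zeta> q" for z
    proof -
      have "z \<in> cball \<zeta> q" using that by simp
      from order_trans[OF bspec[OF M imageI[OF this]] K] show ?thesis .
    qed
  qed (use eq C' in blast)
  moreover have "0 < q" using q zero_le_dist[of \<zeta> x] by linarith
  ultimately show "f \<in> \<Union>(extendability_pieces p \<Omega> \<zeta>)"
    unfolding extendability_pieces_def using q(1) C'(1) by blast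
qed

text \<open>
  As \<open>\<zeta> \<notin> \<Omega>\<close>, the component \<open>C\<close> is not the whole ball, so it has a frontier point \<open>\<eta>\<close> in the ball.
  Such a point cannot lie in \<open>\<Omega>\<close>, since otherwise adding it to \<open>C\<close> would enlarge the component.
  Hence points of \<open>D\<close> close to \<open>\<eta>\<close> have small balls that meet \<open>C\<close> and lie in \<open>ball \<zeta> r\<close>.
\<close>

lemma extendable_at_dense_subset:
  fixes \<Omega> :: "(complex^'n) set"
  assumes "open \<Omega>" and \<zeta>: "\<zeta> \<in> frontier \<Omega>" and ext: "extendable_at \<Omega> f \<zeta>"
    and D: "frontier \<Omega> \<subseteq> closure D"
  shows "\<exists>\<xi>\<in>D. extendable_at \<Omega> f \<xi>"
proof -
  obtain r F C where "0 < r" and F: "holomorphic_several F (ball \<zeta> r)"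
    and C: "C \<in> components (ball \<zeta> r \<inter> \<Omega>)" and eq: "\<forall>z\<in>C. F z = f z"
    using ext unfolding extendable_at_def by blast
  have C_sub: "C \<subseteq> ball \<zeta> r" "C \<subseteq> \<Omega>" using in_components_subset[OF C] by auto
  have "\<zeta> \<notin> \<Omega>" using \<zeta> \<open>open \<Omega>\<close> by (simp add: frontier_def interior_open)
  then have "ball \<zeta> r \<inter> frontier C \<noteq> {}"
    using in_components_nonempty[OF C] C_sub \<open>0 < r\<close>
    by (intro connected_Int_frontier connected_ball) auto
  then obtain \<eta> where \<eta>: "\<eta> \<in> ball \<zeta> r" "\<eta> \<in> frontier C" by blast
  have "open C" by (rule open_components[OF _ C]) (simp add: open_Int \<open>open \<Omega>\<close>)
  then have "\<eta> \<in> closure C" "\<eta> \<notin> C" using \<eta> by (simp_all add: frontier_def interior_open)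
  have "\<eta> \<notin> \<Omega>"
  proof
    assume "\<eta> \<in> \<Omega>"
    have "connected (insert \<eta> C)"
    proof (rule connected_intermediate_closure[OF in_components_connected[OF C]])
      show "insert \<eta> C \<subseteq> closure C"
        using \<open>\<eta> \<in> closure C\<close> closure_subset[of C] by (rule insert_subsetI)
    qed (rule subset_insertI)
    moreover have "insert \<eta> C \<subseteq> ball \<zeta> r \<inter> \<Omega>"
      using \<eta>(1) \<open>\<eta> \<in> \<Omega>\<close> in_components_subset[OF C] by (simp only: insert_subset Int_iff)
    moreover have "C \<inter> insert \<eta> C \<noteq> {}" using in_components_nonempty[OF C] by blast
    ultimately have "insert \<eta> C \<subseteq> C" by (rule components_maximal[OF C])
    then show False using \<open>\<eta> \<notin> C\<close> by blast
  qed
  moreover have "\<eta> \<in> closure \<Omega>" using \<open>\<eta> \<in> closure C\<close> closure_mono[OF C_sub(2)] by blast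
  ultimately have "\<eta> \<in> closure D" using D \<open>open \<Omega>\<close> by (auto simp: frontier_def interior_open)
  obtain d where d: "0 < d" "ball \<eta> d \<subseteq> ball \<zeta> r" using \<eta>(1) by (meson openE open_ball)
  obtain \<xi> where \<xi>: "\<xi> \<in> D" "dist \<xi> \<eta> < d/2"
    using \<open>\<eta> \<in> closure D\<close> d(1) unfolding closure_approachable by (meson half_gt_zero)
  have sub: "ball \<xi> (d/2) \<subseteq> ball \<zeta> r"
  proof -
    have "ball \<xi> (d/2) \<subseteq> ball \<eta> d" using \<xi> by (simp add: ball_subset_ball_iff)
    then show ?thesis using d(2) by blast
  qed
  have "ball \<xi> (d/2) \<inter> C \<noteq> {}"
    using \<open>\<eta> \<in> closure C\<close> \<xi>(2) open_Int_closure_eq_empty[OF open_ball, of \<xi> "d/2" C] by auto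
  then obtain x where x: "x \<in> C" "x \<in> ball \<xi> (d/2)" by blast
  obtain C' where C': "C' \<in> components (ball \<xi> (d/2) \<inter> \<Omega>)" "C' \<subseteq> C"
    using component_nested[OF C x sub] .
  have "extendable_at \<Omega> f \<xi>"
    unfolding extendable_at_def
    using d(1) holomorphic_several_subset[OF F sub] C' eq
    by (intro exI[of _ "d/2"] conjI exI[of _ F] bexI[of _ C']) auto
  then show ?thesis using \<xi>(1) by blast
qed

section \<open>Genericity of non-extendable functions\<close>

lemma dense_gdelta_in_complement_Union:
  assumes "completely_metrizable_space X" "countable \<G>"
    and closed: "\<And>E. E \<in> \<G> \<Longrightarrow> closedin X E" and nowhere: "\<And>E. E \<in> \<G> \<Longrightarrow> X interior_of E = {}"
  shows "dense_gdelta_in X (topspace X - \<Union>\<G>)"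
  unfolding dense_gdelta_in_def
proof
  have "fsigma_in X (\<Union>\<G>)"
    using assms by (intro fsigma_in_Union closed_imp_fsigma_in)
  moreover have "\<Union>\<G> \<subseteq> topspace X" using closed closedin_subset by blast
  ultimately show "gdelta_in X (topspace X - \<Union>\<G>)"
    by (simp add: gdelta_in_fsigma_in double_diff)
  have "X interior_of \<Union>\<G> = {}"
    using assms by (intro Baire_category_alt) auto
  then show "X closure_of (topspace X - \<Union>\<G>) = topspace X"
    by (simp add: closure_of_complement)
qed

lemma star_condition_dense_gdelta:
  fixes \<Omega> :: "(complex^'n) set" and p :: enat
  assumes star: "star_condition \<Omega>"
  shows "\<zeta> \<in> frontier \<Omega> \<Longrightarrow>
           dense_gdelta_in (A_topology p \<Omega>) {f \<in> A_space p \<Omega>. \<not> extendable_at \<Omega> f \<zeta>}"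
    and "dense_gdelta_in (A_topology p \<Omega>) {f \<in> A_space p \<Omega>. non_extendable \<Omega> f}"
proof -
  have "open \<Omega>" using star by (simp add: star_condition_def)
  have pieces: "dense_gdelta_in (A_topology p \<Omega>) (A_space p \<Omega> - \<Union>(\<Union>\<zeta>\<in>D. extendability_pieces p \<Omega> \<zeta>))"
    if D: "countable D" "D \<subseteq> frontier \<Omega>" for D
    unfolding topspace_A_topology[symmetric]
  proof (rule dense_gdelta_in_complement_Union)
    show "completely_metrizable_space (A_topology p \<Omega>)"
      by (rule completely_metrizable_A_topology[OF \<open>open \<Omega>\<close>])
    show "countable (\<Union>\<zeta>\<in>D. extendability_pieces p \<Omega> \<zeta>)"
      using D(1) countable_extendability_pieces[OF \<open>open \<Omega>\<close>] by (rule countable_UN)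
    fix E assume "E \<in> (\<Union>\<zeta>\<in>D. extendability_pieces p \<Omega> \<zeta>)"
    then obtain \<zeta> r C M where \<zeta>: "\<zeta> \<in> frontier \<Omega>" and "0 < r"
      and C: "C \<in> components (ball \<zeta> r \<inter> \<Omega>)" and E: "E = boundedly_extendable p \<Omega> \<zeta> r C (real M)"
      using D(2) unfolding extendability_pieces_def by blast
    have C': "open C" "C \<noteq> {}" "C \<subseteq> ball \<zeta> r" "C \<subseteq> \<Omega>"
      using open_components[OF _ C] \<open>open \<Omega>\<close> in_components_nonempty[OF C] in_components_subset[OF C]
      by (simp_all add: open_Int)
    show "closedin (A_topology p \<Omega>) E"
      unfolding E by (rule closedin_boundedly_extendable[OF \<open>open \<Omega>\<close> C'])
    show "A_topology p \<Omega> interior_of E = {}"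
      unfolding E by (rule interior_boundedly_extendable[OF star \<zeta> \<open>0 < r\<close> C'])
  qed
  show "dense_gdelta_in (A_topology p \<Omega>) {f \<in> A_space p \<Omega>. \<not> extendable_at \<Omega> f \<zeta>}"
    if "\<zeta> \<in> frontier \<Omega>"
  proof -
    have "A_space p \<Omega> - \<Union>(\<Union>\<zeta>\<in>{\<zeta>}. extendability_pieces p \<Omega> \<zeta>) = {f \<in> A_space p \<Omega>. \<not> extendable_at \<Omega> f \<zeta>}"
      using Union_extendability_pieces[of p \<Omega> \<zeta>] by auto
    then show ?thesis using pieces[of "{\<zeta>}"] that by simp
  qed
  obtain D where D: "countable D" "D \<subseteq> frontier \<Omega>" "frontier \<Omega> \<subseteq> closure D"
    by (rule separable)
  have "\<Union>(\<Union>\<zeta>\<in>D. extendability_pieces p \<Omega> \<zeta>) = (\<Union>\<zeta>\<in>D. {f \<in> A_space p \<Omega>. extendable_at \<Omega> f \<zeta>})"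
    using Union_extendability_pieces[of p \<Omega>] by blast
  moreover have "non_extendable \<Omega> f \<longleftrightarrow> (\<forall>\<zeta>\<in>D. \<not> extendable_at \<Omega> f \<zeta>)" for f
    unfolding non_extendable_def using extendable_at_dense_subset[OF \<open>open \<Omega>\<close> _ _ D(3)] D(2) by blast
  ultimately have "A_space p \<Omega> - \<Union>(\<Union>\<zeta>\<in>D. extendability_pieces p \<Omega> \<zeta>) = {f \<in> A_space p \<Omega>. non_extendable \<Omega> f}"
    by auto
  then show "dense_gdelta_in (A_topology p \<Omega>) {f \<in> A_space p \<Omega>. non_extendable \<Omega> f}"
    using pieces[OF D(1,2)] by simp
qed

text \<open>
  Points outside the closure accumulate at every frontier point because a convex open set is the interior
  of its closure, and each of them is separated from the closure by a real hyperplane.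
\<close>

lemma convex_imp_star_condition:
  fixes \<Omega> :: "(complex^'n) set"
  assumes "open \<Omega>" "convex \<Omega>"
  shows "star_condition \<Omega>"
  unfolding star_condition_def
proof (intro conjI ballI allI impI)
  fix \<zeta> and e :: real assume \<zeta>: "\<zeta> \<in> frontier \<Omega>" and "0 < e"
  have "\<zeta> \<notin> interior (closure \<Omega>)"
    using \<zeta> assms by (simp add: convex_interior_closure frontier_def)
  then have "\<not> ball \<zeta> e \<subseteq> closure \<Omega>" using \<open>0 < e\<close> by (meson mem_interior)
  then obtain w where "w \<in> ball \<zeta> e" and w: "w \<notin> closure \<Omega>" by blast
  then have dist: "dist w \<zeta> < e" by (simp add: dist_commute)
  obtain v b where v: "v \<bullet> w < b" "\<And>x. x \<in> closure \<Omega> \<Longrightarrow> b < v \<bullet> x"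
    using separating_hyperplane_closed_point[OF convex_closure[OF assms(2)] closed_closure w] by blast
  have "\<zeta> \<in> closure \<Omega>" using \<zeta> by (simp add: frontier_def)
  then have "v \<noteq> 0" using v by fastforce
  moreover have "cinner z v \<noteq> cinner w v" if "z \<in> closure \<Omega>" for z
  proof
    assume "cinner z v = cinner w v"
    then have "z \<bullet> v = w \<bullet> v" by (metis Re_cinner)
    then show False using v(1) v(2)[OF that] by (simp add: inner_commute)
  qed
  ultimately show "\<exists>w. w \<notin> closure \<Omega> \<and> dist w \<zeta> < e \<and>
      (\<exists>v. v \<noteq> 0 \<and> {z. cinner z v = cinner w v} \<inter> closure \<Omega> = {})"
    using w dist by blast
qed (use assms convex_connected in auto)

theorem theorem4:
  fixes \<Omega> :: "(complex^'n) set" and p :: enat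
  shows "(star_condition \<Omega> \<longrightarrow>
            (\<forall>\<zeta>\<in>frontier \<Omega>.
               dense_gdelta_in (A_topology p \<Omega>) {f \<in> A_space p \<Omega>. \<not> extendable_at \<Omega> f \<zeta>}) \<and>
            dense_gdelta_in (A_topology p \<Omega>) {f \<in> A_space p \<Omega>. non_extendable \<Omega> f}) \<and>
         (open \<Omega> \<and> convex \<Omega> \<longrightarrow>
            (\<forall>\<zeta>\<in>frontier \<Omega>.
               dense_gdelta_in (A_topology p \<Omega>) {f \<in> A_space p \<Omega>. \<not> extendable_at \<Omega> f \<zeta>}) \<and>
            dense_gdelta_in (A_topology p \<Omega>) {f \<in> A_space p \<Omega>. non_extendable \<Omega> f})"
  using star_condition_dense_gdelta convex_imp_star_condition by blast

end
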